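(* Let $\varepsilon(\mathbf{x})$, $\mathbf{x}\in\mathbb{R}^3$, be a random field that describes the stress tensor of a deformable body, that is, a second-order, mean-square continuous, wide-sense homogeneous and wide-sense isotropic random field with values in the space $\mathsf{S}^2(\mathbb{R}^3)$ of symmetric $3\times 3$ real matrices, where $\mathrm{O}(3)$ acts on $\mathsf{S}^2(\mathbb{R}^3)$ by $U(g)\mathsf{e}=g\mathsf{e}g^{\top}$. The following conditions are equivalent. 1. In the representation $$\langle\varepsilon(\mathbf{x}),\varepsilon(\mathbf{y})\rangle_{ijkl}=\frac{1}{4\pi}\int_0^{\infty}\int_{S^2}e^{\mathrm{i}(\mathbf{p},\mathbf{y}-\mathbf{x})}f_{ijkl}(\lambda,\varphi_{\mathbf{p}},\theta_{\mathbf{p}})\sin\theta_{\mathbf{p}}\,\mathrm{d}\varphi_{\mathbf{p}}\,\mathrm{d}\theta_{\mathbf{p}}\,\mathrm{d}\nu(\lambda)$$ of the two-point correlation tensor of the field (with $\nu$ and $f$ as described in the context), the $6\times 6$ matrix $\tau f_{ijkl}(\lambda,0,0)$ with $\lambda>0$ takes values in the simplex with vertices $D^1,\dots,D^5$ (the matrices $D^n$ and the map $\tau$ are given in the context). 2. The two-point correlation tensor of the field has the spectral expansion $$\langle\varepsilon(\mathbf{x}),\varepsilon(\mathbf{y})\rangle_{ijkl}=\sum_{n=1}^{5}\int_0^{\infty}\sum_{q=1}^{5}\tilde N_{nq}(\lambda,\|\mathbf{r}\|)L^q_{ijkl}(\mathbf{r})\,\mathrm{d}\Phi_n(\lambda),\qquad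 \mathbf{r}=\mathbf{y}-\mathbf{x},$$ where the functions $\tilde N_{nq}$ and the tensors $L^q$ are given in the context, and where $\Phi_1,\dots,\Phi_5$ are five finite measures on $[0,\infty)$ with $$\Phi_1(\{0\})=\Phi_2(\{0\})=2\Phi_4(\{0\}),\qquad \Phi_5(\{0\})=0.$$
   Context: **Random fields.** A random field $\varepsilon(\mathbf{x})$ is second-order if $\mathsf{E}\|\varepsilon(\mathbf{x})\|^2<\infty$ for all $\mathbf{x}$. Its one-point correlation tensor is $\langle\varepsilon(\mathbf{x})\rangle=\mathsf{E}[\varepsilon(\mathbf{x})]$, and its two-point correlation tensor is $$\langle\varepsilon(\mathbf{x}),\varepsilon(\mathbf{y})\rangle=\mathsf{E}[(\varepsilon(\mathbf{x})-\langle\varepsilon(\mathbf{x})\rangle)\otimes(\varepsilon(\mathbf{y})-\langle\varepsilon(\mathbf{y})\rangle)],$$ with components $\langle\varepsilon(\mathbf{x}),\varepsilon(\mathbf{y})\rangle_{ijkl}$, the covariance of $\varepsilon_{ij}(\mathbf{x})$ and $\varepsilon_{kl}(\mathbf{y})$. The field is mean-square continuous if the two-point correlation tensor is a continuous function. It is wide-sense homogeneous if the one-point correlation tensor is constant and the two-point correlation tensor depends only on $\mathbf{y}-\mathbf{x}$. It is wide-sense isotropic (with respect to $U$) if $\langle\varepsilon(g\mathbf{x})\rangle=U(g)\langle\varepsilon(\mathbf{x})\rangle$ and $\langle\varepsilon(g\mathbf{x}),\varepsilon(g\mathbf{y})\rangle=(U\otimes U)(g)\langle\varepsilon(\mathbf{x}),\varepsilon(\mathbf{y})\rangle$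 for all $g\in\mathrm{O}(3)$. **Coordinates.** Coordinates in $\mathbb{R}^3$ and in the wavenumber space $\hat{\mathbb{R}}^3$ are indexed by $-1,0,1$. Spherical coordinates $(\lambda,\varphi_{\mathbf{p}},\theta_{\mathbf{p}})$ of $\mathbf{p}\in\hat{\mathbb{R}}^3$ are given by $p_{-1}=\lambda\sin\theta_{\mathbf{p}}\sin\varphi_{\mathbf{p}}$, $p_0=\lambda\cos\theta_{\mathbf{p}}$, $p_1=\lambda\sin\theta_{\mathbf{p}}\cos\varphi_{\mathbf{p}}$. All indices $i,j,k,l$ range over $\{-1,0,1\}$. **The measure $\nu$ and the function $f$.** $\nu$ is a finite measure on $[0,\infty)$, and $f$ is a measurable function on $\hat{\mathbb{R}}^3$, written in spherical coordinates, taking values in the set of symmetric nonnegative-definite operators on $\mathsf{S}^2(\mathbb{R}^3)$ with unit trace and satisfying $f(g\mathbf{p})=\mathsf{S}^2(U)(g)f(\mathbf{p})$, that is, $f(g\mathbf{p})=U(g)f(\mathbf{p})U(g)^{-1}$, for all $\mathbf{p}\in\hat{\mathbb{R}}^3$ and $g\in\mathrm{O}(3)$. **Matrix form of rank 4 tensors.** A symmetric operator on $\mathsf{S}^2(\mathbb{R}^3)$ is identified with a tensor $f_{ijkl}$ with $f_{ijkl}=f_{jikl}=f_{ijlk}=f_{klij}$. The orthogonal operator $\tau$ from $\mathsf{S}^2(\mathsf{S}^2(\mathbb{R}^3))$ to $\mathsf{S}^2(\mathbb{R}^6)$ sends it to a symmetric $6\times 6$ matrix whose rows and columns $1,\dots,6$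 correspond to the index pairs $(-1,-1),(0,0),(1,1),(-1,0),(0,1),(1,-1)$. The entry of $\tau f$ at row pair $(i,j)$ and column pair $(k,l)$ is $c_{ij}c_{kl}f_{ijkl}$, where $c_{ij}=1$ if $i=j$ and $c_{ij}=\sqrt2$ if $i\ne j$. **The simplex.** It is the convex hull of five symmetric $6\times6$ matrices whose nonzero entries on and above the main diagonal are as follows. - $D^1$: $D^1_{44}=D^1_{66}=\frac12$. - $D^2$: $D^2_{11}=D^2_{33}=\frac14$, $D^2_{55}=\frac12$, $D^2_{13}=-\frac14$. - $D^3$: $D^3_{11}=D^3_{12}=D^3_{13}=D^3_{22}=D^3_{23}=D^3_{33}=\frac13$. - $D^4$: $D^4_{11}=D^4_{33}=D^4_{13}=\frac16$, $D^4_{22}=\frac23$, $D^4_{12}=D^4_{23}=-\frac13$. - $D^5$: $D^5_{11}=D^5_{33}=D^5_{13}=\frac12$. **The tensors $L^q$.** $$L^1_{ijkl}=\delta_{ij}\delta_{kl},\qquad L^2_{ijkl}=\delta_{ik}\delta_{jl}+\delta_{il}\delta_{jk},$$ $$\|\mathbf{r}\|^2L^3_{ijkl}(\mathbf{r})=\delta_{il}r_jr_k+\delta_{jk}r_ir_l+\delta_{jl}r_ir_k+\delta_{ik}r_jr_l,$$ $$\|\mathbf{r}\|^2L^4_{ijkl}(\mathbf{r})=\delta_{kl}r_ir_j+\delta_{ij}r_kr_l,\qquad \|\mathbf{r}\|^4L^5_{ijkl}(\mathbf{r})=r_ir_jr_kr_l.$$ For $\mathbf{r}=\mathbf{0}$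 the terms containing $L^3,L^4,L^5$ are understood to be zero (their coefficients vanish there). **The functions $\tilde N_{nq}(\lambda,r)$.** Let $j_0,j_2,j_4$ be spherical Bessel functions, all evaluated at $\lambda r$. The functions not listed are zero. - $\tilde N_{11}=-\frac1{15}j_0-\frac2{21}j_2-\frac1{35}j_4$; $\tilde N_{12}=\frac1{10}j_0+\frac1{14}j_2-\frac1{35}j_4$; $\tilde N_{13}=-\frac3{28}j_2+\frac17j_4$; $\tilde N_{14}=\frac17j_2+\frac17j_4$; $\tilde N_{15}=-j_4$. - $\tilde N_{21}=-\frac1{15}j_0+\frac4{21}j_2+\frac1{140}j_4$; $\tilde N_{22}=\frac1{10}j_0-\frac17j_2+\frac1{140}j_4$; $\tilde N_{23}=\frac3{14}j_2-\frac1{28}j_4$; $\tilde N_{24}=-\frac27j_2-\frac1{28}j_4$; $\tilde N_{25}=\frac14j_4$. - $\tilde N_{31}=\frac13j_0$. - $\tilde N_{41}=-\frac1{135}j_0-\frac4{21}j_2+\frac3{70}j_4$; $\tilde N_{42}=\frac1{90}j_0+\frac17j_2+\frac3{70}j_4$; $\tilde N_{43}=-\frac3{14}j_2-\frac3{14}j_4$; $\tilde N_{44}=\frac27j_2-\frac3{14}j_4$; $\tilde N_{45}=\frac32j_4$. - $\tilde N_{51}=\frac15j_0-\frac27j_2+\frac1{70}j_4$; $\tilde N_{52}=\frac1{30}j_0+\frac2{21}j_2+\frac1{70}j_4$; $\tilde N_{53}=\frac1{14}j_2-\frac1{14}j_4$; $\tilde N_{54}=\frac5{21}j_2-\frac1{14}j_4$;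 $\tilde N_{55}=\frac12j_4$.
   Formalization: Corrected data: rows 5, 6 of τ correspond to (1,-1), (0,1); the j2-coefficients of Ñ52, Ñ53, Ñ54 are 1/21, -1/14, 3/7; the j0-coefficients of Ñ41, Ñ42 are -1/15, 1/10. With the data as printed the equivalence is false. *)

theory Defs
  imports "HOL-Probability.Probability"
begin

text \<open>
  Coordinates are indexed by the elements \<open>-1\<close>, \<open>0\<close>, \<open>1\<close> of the three-element
  type \<open>3\<close>, whose arithmetic is modulo 3 (so \<open>-1 = 2\<close> and \<open>0 = 3\<close>). Rank 2 and rank 4
  tensors are nested vectors: \<open>F $ i $ j $ k $ l\<close> is the component \<open>F\<^sub>i\<^sub>j\<^sub>k\<^sub>l\<close>.
\<close>

type_synonym vec3 = "real^3"
type_synonym tensor2 = "real^3^3"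
type_synonym tensor4 = "real^3^3^3^3"

definition S2 :: "tensor2 set" where
  "S2 = {e. transpose e = e}"

definition U :: "real^3^3 \<Rightarrow> tensor2 \<Rightarrow> tensor2" where
  "U g e = g ** e ** transpose g"

definition tensor_prod :: "tensor2 \<Rightarrow> tensor2 \<Rightarrow> tensor4" where
  "tensor_prod a b = (\<chi> i j k l. a $ i $ j * b $ k $ l)"

text \<open>The action \<open>U \<otimes> U\<close>; its restriction to the symmetric rank 4 tensors is \<open>S\<^sup>2(U)\<close>.\<close>
definition UU :: "real^3^3 \<Rightarrow> tensor4 \<Rightarrow> tensor4" where
  "UU g F = (\<chi> i j k l. \<Sum>a\<in>UNIV. \<Sum>b\<in>UNIV. \<Sum>c\<in>UNIV. \<Sum>d\<in>UNIV.
     g $ i $ a * g $ j $ b * g $ k $ c * g $ l $ d * F $ a $ b $ c $ d)"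

definition tensor_op :: "tensor4 \<Rightarrow> tensor2 \<Rightarrow> tensor2" where
  "tensor_op F e = (\<chi> i j. \<Sum>k\<in>UNIV. \<Sum>l\<in>UNIV. F $ i $ j $ k $ l * e $ k $ l)"


section \<open>Random fields\<close>

definition one_point :: "'w measure \<Rightarrow> (vec3 \<Rightarrow> 'w \<Rightarrow> tensor2) \<Rightarrow> vec3 \<Rightarrow> tensor2" where
  "one_point M \<epsilon> x = (LINT \<omega>|M. \<epsilon> x \<omega>)"

definition two_point :: "'w measure \<Rightarrow> (vec3 \<Rightarrow> 'w \<Rightarrow> tensor2) \<Rightarrow> vec3 \<Rightarrow> vec3 \<Rightarrow> tensor4" where
  "two_point M \<epsilon> x y =
     (LINT \<omega>|M. tensor_prod (\<epsilon> x \<omega> - one_point M \<epsilon> x) (\<epsilon> y \<omega> - one_point M \<epsilon> y))"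

definition S2_random_field :: "'w measure \<Rightarrow> (vec3 \<Rightarrow> 'w \<Rightarrow> tensor2) \<Rightarrow> bool" where
  "S2_random_field M \<epsilon> \<longleftrightarrow> (\<forall>x. \<epsilon> x \<in> borel_measurable M \<and> (\<forall>\<omega>\<in>space M. \<epsilon> x \<omega> \<in> S2))"

definition second_order :: "'w measure \<Rightarrow> (vec3 \<Rightarrow> 'w \<Rightarrow> tensor2) \<Rightarrow> bool" where
  "second_order M \<epsilon> \<longleftrightarrow> (\<forall>x. integrable M (\<lambda>\<omega>. (norm (\<epsilon> x \<omega>))\<^sup>2))"

definition mean_square_continuous :: "'w measure \<Rightarrow> (vec3 \<Rightarrow> 'w \<Rightarrow> tensor2) \<Rightarrow> bool" where
  "mean_square_continuous M \<epsilon> \<longleftrightarrow> continuous_on UNIV (\<lambda>(x, y). two_point M \<epsilon> x y)"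

definition wide_sense_homogeneous :: "'w measure \<Rightarrow> (vec3 \<Rightarrow> 'w \<Rightarrow> tensor2) \<Rightarrow> bool" where
  "wide_sense_homogeneous M \<epsilon> \<longleftrightarrow>
     (\<exists>m. \<forall>x. one_point M \<epsilon> x = m) \<and> (\<exists>R. \<forall>x y. two_point M \<epsilon> x y = R (y - x))"

definition wide_sense_isotropic :: "'w measure \<Rightarrow> (vec3 \<Rightarrow> 'w \<Rightarrow> tensor2) \<Rightarrow> bool" where
  "wide_sense_isotropic M \<epsilon> \<longleftrightarrow> (\<forall>g. orthogonal_matrix g \<longrightarrow>
     (\<forall>x. one_point M \<epsilon> (g *v x) = U g (one_point M \<epsilon> x)) \<and>
     (\<forall>x y. two_point M \<epsilon> (g *v x) (g *v y) = UU g (two_point M \<epsilon> x y)))"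


section \<open>Spectral data\<close>

definition spherical :: "real \<Rightarrow> real \<Rightarrow> real \<Rightarrow> vec3" where
  "spherical \<rho> \<phi> \<theta> = (\<chi> i. if i = -1 then \<rho> * sin \<theta> * sin \<phi>
     else if i = 0 then \<rho> * cos \<theta> else \<rho> * sin \<theta> * cos \<phi>)"

definition finite_measure_on_halfline :: "real measure \<Rightarrow> bool" where
  "finite_measure_on_halfline \<mu> \<longleftrightarrow>
     finite_measure \<mu> \<and> sets \<mu> = sets (restrict_space borel {0..})"

text \<open>
  The positions of the index pairs \<open>(0,1)\<close> and \<open>(1,-1)\<close> are forced: the values at
  \<open>spherical \<rho> 0 0\<close>, on the axis with index \<open>0\<close>, of an equivariant \<open>f\<close> have equal diagonal
  entries at \<open>(-1,0)\<close> and \<open>(0,1)\<close> (lemma \<open>spectral_density_axis\<close> below), and it is at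
  positions 4 and 6 that each of the matrices \<open>D\<close> below has equal entries. The
  published list has \<open>(0,1)\<close> at position 5 and \<open>(1,-1)\<close> at position 6, which
  contradicts the published matrices \<open>D\<close>.
\<close>
definition index_pair :: "6 \<Rightarrow> 3 \<times> 3" where
  "index_pair m = (if m = 1 then (-1, -1) else if m = 2 then (0, 0) else if m = 3 then (1, 1)
     else if m = 4 then (-1, 0) else if m = 5 then (1, -1) else (0, 1))"

definition tau :: "tensor4 \<Rightarrow> real^6^6" where
  "tau F = (\<chi> m n. case (index_pair m, index_pair n) of ((i, j), (k, l)) \<Rightarrow>
     (if i = j then 1 else sqrt 2) * (if k = l then 1 else sqrt 2) * F $ i $ j $ k $ l)"

text \<open>
  Symmetric nonnegative-definite operators on \<open>S2\<close> with unit trace. The matrix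
  \<open>tau F\<close> is the matrix of \<open>tensor_op F\<close> in an orthonormal basis of \<open>S2\<close>.
\<close>
definition unit_trace_psd :: "tensor4 set" where
  "unit_trace_psd = {F. (\<forall>i j k l. F $ i $ j $ k $ l = F $ j $ i $ k $ l \<and>
       F $ i $ j $ k $ l = F $ i $ j $ l $ k \<and> F $ i $ j $ k $ l = F $ k $ l $ i $ j) \<and>
     (\<forall>e\<in>S2. 0 \<le> e \<bullet> tensor_op F e) \<and> trace (tau F) = 1}"

definition spectral_density :: "(vec3 \<Rightarrow> tensor4) \<Rightarrow> bool" where
  "spectral_density f \<longleftrightarrow> f \<in> borel_measurable borel \<and> (\<forall>p. f p \<in> unit_trace_psd) \<and>
     (\<forall>g p. orthogonal_matrix g \<longrightarrow> f (g *v p) = UU g (f p))"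

definition D1 :: "real^6^6" where
  "D1 = vector [vector [0, 0, 0, 0, 0, 0],
                vector [0, 0, 0, 0, 0, 0],
                vector [0, 0, 0, 0, 0, 0],
                vector [0, 0, 0, 1/2, 0, 0],
                vector [0, 0, 0, 0, 0, 0],
                vector [0, 0, 0, 0, 0, 1/2]]"

definition D2 :: "real^6^6" where
  "D2 = vector [vector [1/4, 0, -1/4, 0, 0, 0],
                vector [0, 0, 0, 0, 0, 0],
                vector [-1/4, 0, 1/4, 0, 0, 0],
                vector [0, 0, 0, 0, 0, 0],
                vector [0, 0, 0, 0, 1/2, 0],
                vector [0, 0, 0, 0, 0, 0]]"

definition D3 :: "real^6^6" where
  "D3 = vector [vector [1/3, 1/3, 1/3, 0, 0, 0],
                vector [1/3, 1/3, 1/3, 0, 0, 0],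
                vector [1/3, 1/3, 1/3, 0, 0, 0],
                vector [0, 0, 0, 0, 0, 0],
                vector [0, 0, 0, 0, 0, 0],
                vector [0, 0, 0, 0, 0, 0]]"

definition D4 :: "real^6^6" where
  "D4 = vector [vector [1/6, -1/3, 1/6, 0, 0, 0],
                vector [-1/3, 2/3, -1/3, 0, 0, 0],
                vector [1/6, -1/3, 1/6, 0, 0, 0],
                vector [0, 0, 0, 0, 0, 0],
                vector [0, 0, 0, 0, 0, 0],
                vector [0, 0, 0, 0, 0, 0]]"

definition D5 :: "real^6^6" where
  "D5 = vector [vector [1/2, 0, 1/2, 0, 0, 0],
                vector [0, 0, 0, 0, 0, 0],
                vector [1/2, 0, 1/2, 0, 0, 0],
                vector [0, 0, 0, 0, 0, 0],
                vector [0, 0, 0, 0, 0, 0],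
                vector [0, 0, 0, 0, 0, 0]]"


section \<open>The spectral expansion\<close>

definition kron :: "3 \<Rightarrow> 3 \<Rightarrow> real" where
  "kron i j = (if i = j then 1 else 0)"

text \<open>For \<open>r = 0\<close> the last three tensors vanish, since division by zero yields zero.\<close>
definition L :: "nat \<Rightarrow> vec3 \<Rightarrow> 3 \<Rightarrow> 3 \<Rightarrow> 3 \<Rightarrow> 3 \<Rightarrow> real" where
  "L q r i j k l =
    [kron i j * kron k l,
     kron i k * kron j l + kron i l * kron j k,
     (kron i l * (r $ j * r $ k) + kron j k * (r $ i * r $ l) +
      kron j l * (r $ i * r $ k) + kron i k * (r $ j * r $ l)) / (norm r)\<^sup>2,
     (kron k l * (r $ i * r $ j) + kron i j * (r $ k * r $ l)) / (norm r)\<^sup>2,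
     (r $ i * r $ j * r $ k * r $ l) / (norm r)^4] ! (q - 1)"

definition bessel_J :: "real \<Rightarrow> real \<Rightarrow> real" where
  "bessel_J a x = (\<Sum>k. (-1)^k / (fact k * Gamma (real k + a + 1)) * (x / 2) powr (2 * real k + a))"

text \<open>For nonnegative arguments; the value at 0 is the limit.\<close>
definition spherical_bessel :: "nat \<Rightarrow> real \<Rightarrow> real" where
  "spherical_bessel n x = (if x = 0 then (if n = 0 then 1 else 0)
     else sqrt (pi / (2 * x)) * bessel_J (real n + 1/2) x)"

text \<open>
  The functions \<open>N_tilde n q\<close>, \<open>q = 1, \<dots>, 5\<close>, are the coefficients of the average over
  the sphere of radius \<open>\<rho>\<close> of \<open>exp(\<i>(p,r))\<close> times the rotated tensor with matrix \<open>D\<^sup>n\<close>.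
  The average differs from the published table in five places:
  \<open>N\<^sub>4\<^sub>1\<close> and \<open>N\<^sub>4\<^sub>2\<close> are published with \<open>j0\<close>-coefficients \<open>-1/135\<close> and \<open>1/90\<close>, and
  \<open>N\<^sub>5\<^sub>2\<close>, \<open>N\<^sub>5\<^sub>3\<close>, \<open>N\<^sub>5\<^sub>4\<close> with \<open>j2\<close>-coefficients \<open>2/21\<close>, \<open>1/14\<close>, \<open>5/21\<close>. As the operators
  have unit trace, the double contraction of each row must be \<open>j0\<close>
  (lemma \<open>N_tilde_contraction\<close> below); the published rows 4 and 5 violate this.
\<close>
definition N_tilde :: "nat \<Rightarrow> nat \<Rightarrow> real \<Rightarrow> real \<Rightarrow> real" where
  "N_tilde n q \<rho> r =
    (let j0 = spherical_bessel 0 (\<rho> * r);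
         j2 = spherical_bessel 2 (\<rho> * r);
         j4 = spherical_bessel 4 (\<rho> * r)
     in [[- 1/15 * j0 - 2/21 * j2 - 1/35 * j4,
          1/10 * j0 + 1/14 * j2 - 1/35 * j4,
          - 3/28 * j2 + 1/7 * j4,
          1/7 * j2 + 1/7 * j4,
          - j4],
         [- 1/15 * j0 + 4/21 * j2 + 1/140 * j4,
          1/10 * j0 - 1/7 * j2 + 1/140 * j4,
          3/14 * j2 - 1/28 * j4,
          - 2/7 * j2 - 1/28 * j4,
          1/4 * j4],
         [1/3 * j0, 0, 0, 0, 0],
         [- 1/15 * j0 - 4/21 * j2 + 3/70 * j4,
          1/10 * j0 + 1/7 * j2 + 3/70 * j4,
          - 3/14 * j2 - 3/14 * j4,
          2/7 * j2 - 3/14 * j4,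
          3/2 * j4],
         [1/5 * j0 - 2/7 * j2 + 1/70 * j4,
          1/30 * j0 + 1/21 * j2 + 1/70 * j4,
          - 1/14 * j2 - 1/14 * j4,
          3/7 * j2 - 1/14 * j4,
          1/2 * j4]] ! (n - 1) ! (q - 1))"


section \<open>Consistency checks\<close>

lemma UU_tensor_prod: "UU g (tensor_prod a b) = tensor_prod (U g a) (U g b)"
proof -
  have *: "U g e $ i $ j = (\<Sum>c\<in>UNIV. \<Sum>d\<in>UNIV. g $ i $ c * g $ j $ d * e $ c $ d)" for e i j
    unfolding U_def matrix_matrix_mult_def transpose_def
    by (simp add: sum_distrib_right) (subst sum.swap, simp add: mult_ac)
  show ?thesis
    unfolding vec_eq_iff
    by (simp add: UU_def tensor_prod_def *)
       (simp only: sum_distrib_right, simp only: sum_distrib_left mult_ac, intro allI refl)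
qed

lemma index_3: "(2::3) = -1" "(3::3) = 0"
  by simp_all

lemma sum_index: "(\<Sum>i\<in>UNIV. f i) = f (-1) + f 0 + (f (1::3) :: real)"
  unfolding sum_3 index_3 by linarith

lemma forall_index: "(\<forall>i::3. P i) \<longleftrightarrow> P (-1) \<and> P 0 \<and> P 1"
  unfolding forall_3 index_3 by blast

lemma spectral_density_axis:
  assumes "spectral_density f"
  shows "f (spherical \<rho> 0 0) $ (-1) $ 0 $ (-1) $ 0 = f (spherical \<rho> 0 0) $ 0 $ 1 $ 0 $ 1"
proof -
  define g :: "real^3^3" where "g = (\<chi> i j. if j = - i then 1 else 0)"
  define p where "p = spherical \<rho> 0 0"
  have "orthogonal_matrix g"
    unfolding orthogonal_matrix g_def
    by (simp add: vec_eq_iff transpose_def matrix_matrix_mult_def mat_def sum_index forall_index)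
  moreover have "g *v p = p"
    by (simp add: g_def p_def spherical_def vec_eq_iff matrix_vector_mult_def sum_index forall_index)
  ultimately have inv: "f p = UU g (f p)" and sym: "f p \<in> unit_trace_psd"
    using assms by (metis spectral_density_def)+
  have "f p $ (-1) $ 0 $ (-1) $ 0 = UU g (f p) $ (-1) $ 0 $ (-1) $ 0"
    using inv by simp
  also have "\<dots> = f p $ 1 $ 0 $ 1 $ 0"
    by (simp add: UU_def g_def sum_index)
  also have "\<dots> = f p $ 0 $ 1 $ 0 $ 1"
    using sym unfolding unit_trace_psd_def by (metis (mono_tags, lifting) mem_Collect_eq)
  finally show ?thesis
    unfolding p_def .
qed

lemma N_tilde_contraction:
  assumes "n \<in> {1..5}" "r \<noteq> 0"
  shows "(\<Sum>i\<in>UNIV. \<Sum>j\<in>UNIV. \<Sum>q=1..5. N_tilde n q \<rho> (norm r) * L q r i j i j) =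
    spherical_bessel 0 (\<rho> * norm r)"
proof -
  define s where "s = (norm r)\<^sup>2"
  have "s \<noteq> 0"
    using assms by (simp add: s_def)
  have s: "s = r $ 1 * r $ 1 + r $ 2 * r $ 2 + r $ 3 * r $ 3"
    unfolding s_def power2_norm_eq_inner by (simp add: inner_vec_def sum_3)
  have pow4: "norm r ^ 4 = s * s"
    unfolding s_def by (simp add: power2_eq_square power4_eq_xxxx)
  have 1: "(\<Sum>i\<in>UNIV. \<Sum>j\<in>UNIV. L 1 r i j i j) = 3"
    and 2: "(\<Sum>i\<in>UNIV. \<Sum>j\<in>UNIV. L 2 r i j i j) = 12"
    by (simp_all add: L_def kron_def sum_3)
  have 3: "(\<Sum>i\<in>UNIV. \<Sum>j\<in>UNIV. L 3 r i j i j) = 8"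
    and 4: "(\<Sum>i\<in>UNIV. \<Sum>j\<in>UNIV. L 4 r i j i j) = 2"
    using \<open>s \<noteq> 0\<close> unfolding s_def[symmetric]
    by (simp_all add: L_def kron_def sum_3 s_def[symmetric] add_divide_distrib[symmetric])
       (simp_all add: s field_simps)
  have 5: "(\<Sum>i\<in>UNIV. \<Sum>j\<in>UNIV. L 5 r i j i j) = 1"
    using \<open>s \<noteq> 0\<close>
    by (simp add: L_def sum_3 pow4 add_divide_distrib[symmetric]) (simp add: s algebra_simps)
  have "(\<Sum>i\<in>UNIV. \<Sum>j\<in>UNIV. \<Sum>q=1..5. N_tilde n q \<rho> (norm r) * L q r i j i j) =
      (\<Sum>q=1..5. N_tilde n q \<rho> (norm r) * (\<Sum>i\<in>UNIV. \<Sum>j\<in>UNIV. L q r i j i j))"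
    unfolding sum_distrib_left
    by (subst (2) sum.swap, subst sum.swap, simp)
  also have "\<dots> = 3 * N_tilde n 1 \<rho> (norm r) + 12 * N_tilde n 2 \<rho> (norm r) +
      8 * N_tilde n 3 \<rho> (norm r) + 2 * N_tilde n 4 \<rho> (norm r) + N_tilde n 5 \<rho> (norm r)"
    using 1 2 3 4 5 by (simp add: numeral_eq_Suc)
  also have "\<dots> = spherical_bessel 0 (\<rho> * norm r)"
  proof -
    consider "n = 1" | "n = 2" | "n = 3" | "n = 4" | "n = 5"
      using assms by fastforce
    then show ?thesis
      by cases (simp_all add: N_tilde_def Let_def field_simps)
  qed
  finally show ?thesis .
qed

end

(*
  On the sphere of radius rho an equivariant density f is determined by its value at the pole,
  where the simplex condition writes tau f as a convex combination, with weights u_n, of the D^n.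
  By equivariance f = sum_n u_n T^n, where T^n(p) is the combination of the tensors L^q(p) whose
  matrix at the pole is D^n, so Phi_n has density u_n with respect to nu.
  Averaging exp(i(p,r)) T^n(p) over the sphere requires the moments of a plane wave up to order four.
  The moment of order zero is sin s / s with s = rho |r|; the others follow by differentiating in r,
  because b_n(s^2) = j_n(s) / s^n satisfies b_n' = - b_(n+1) / 2.
  At rho = 0 the density is invariant under the whole of O(3), which forces u_1 = u_2 = 2 u_4 and
  u_5 = 0. Conversely the u_n are Radon-Nikodym derivatives with respect to the sum of the Phi_n.
*)
theory Submission
  imports Defs
begin

section \<open>Spherical Bessel functions\<close>

text \<open>The Bessel functions enter as power series in the square of the argument: |r|^2 is a
  polynomial in r, so differentiation in r remains possible at r = 0, where |r| itself is not
  differentiable. The rotation invariance behind sin s / s is obtained without a change of variables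
  on the sphere: the integral is shown to have zero derivative in both angles of r. Two obstacles
  shape the rest. The simplex condition says nothing at \<rho> = 0, so the weights there must be
  found from the invariance of f(0) alone. And Radon-Nikodym derivatives are determined only almost
  everywhere, whereas a density must have unit trace, positivity and equivariance at every point;
  they are therefore altered on a null set, and the conditions on the atoms at 0 make f(0) invariant
  when 0 carries mass. The weights are measurable because they are linear functionals of the matrix
  entries, dual to the vertices.\<close>

definition bessel_coeff :: "nat \<Rightarrow> nat \<Rightarrow> real" where
  "bessel_coeff n k =
     (-1)^k * sqrt pi / (fact k * Gamma (real k + real n + 3/2) * 2^(2 * k + n + 1))"

text \<open>This is b_n, entire in t = s^2. The power of 2 in the coefficients collects the powers
  of s / 2 and the factor sqrt(pi) / 2 that the half-integer power leaves behind.\<close>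

definition bessel_series :: "nat \<Rightarrow> real \<Rightarrow> real" where
  "bessel_series n t = (\<Sum>k. bessel_coeff n k * t^k)"

lemma Gamma_half_pos: "Gamma (real k + real n + 3/2) > 0"
  by (rule Gamma_real_pos) simp

lemma Gamma_half_Suc:
  "Gamma (real (Suc k) + real n + 3/2) = (real k + real n + 3/2) * Gamma (real k + real n + 3/2)"
proof -
  have "real k + real n + 3/2 \<notin> \<int>\<^sub>\<le>\<^sub>0"
    by (auto elim!: nonpos_Ints_cases)
  from Gamma_plus1[OF this] show ?thesis
    by (simp add: add_ac)
qed

text \<open>Coefficientwise b_n' = - b_(n+1) / 2: the same Gamma value stands on both sides, and the
  factor \<open>Suc k\<close> cancels against the factorial.\<close>

lemma bessel_coeff_Suc_Suc: "bessel_coeff (Suc n) k = - 2 * (real (Suc k) * bessel_coeff n (Suc k))"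
proof -
  define G where "G = Gamma (real (Suc k) + real n + 3/2)"
  have "Gamma (real k + real (Suc n) + 3/2) = G" "G > 0"
    using Gamma_half_pos[of "Suc k" n] by (simp_all add: G_def add_ac)
  then show ?thesis
    unfolding bessel_coeff_def G_def[symmetric] by (simp add: field_simps del: of_nat_Suc)
qed

text \<open>Raising n alone shifts the Gamma argument by one, so the factor comes from the
  functional equation of Gamma.\<close>

lemma bessel_coeff_Suc:
  "bessel_coeff n k = 2 * (real k + real n + 3/2) * bessel_coeff (Suc n) k"
proof -
  define G where "G = Gamma (real k + real n + 3/2)"
  define z where "z = real k + real n + 3/2"
  have G: "Gamma z = G"
    by (simp add: G_def z_def)
  have 1: "Gamma (real k + real (Suc n) + 3/2) = z * G"
    using Gamma_half_Suc[of k n] by (simp add: G_def z_def add_ac)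
  have "z > 0" "G > 0"
    using Gamma_half_pos[of k n] by (simp_all add: G_def z_def add_nonneg_pos)
  then show ?thesis
    unfolding bessel_coeff_def 1 z_def[symmetric] G by (simp add: field_simps)
qed

text \<open>Combining the two coefficient relations at n = 0 raises k by one, which reproduces the
  Taylor coefficients of sin s / s.\<close>

lemma bessel_coeff_0: "bessel_coeff 0 k = (-1)^k / fact (2 * k + 1)"
proof (induction k)
  case 0
  have "Gamma (3/2 :: real) = 1/2 * Gamma (1/2)"
    using Gamma_plus1[of "1/2 :: real"] by (force elim!: nonpos_Ints_cases)
  then show ?case
    by (simp add: bessel_coeff_def Gamma_one_half_real)
next
  case (Suc k)
  have "bessel_coeff 0 k = - ((2 * real k + 3) * (2 * real k + 2)) * bessel_coeff 0 (Suc k)"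
    unfolding bessel_coeff_Suc[of 0 k] bessel_coeff_Suc_Suc[of 0 k] by (simp add: algebra_simps)
  then have "bessel_coeff 0 (Suc k) = - bessel_coeff 0 k / ((2 * real k + 3) * (2 * real k + 2))"
    by (subst nonzero_eq_divide_eq) (simp_all add: mult.commute)
  then show ?case
    unfolding Suc by (simp add: field_simps)
qed

text \<open>The Gamma values increase with k, each step multiplying by at least 3/2, so the terms
  are dominated by an exponential series.\<close>

lemma summable_bessel: "summable (\<lambda>k. bessel_coeff n k * t^k)"
proof (rule summable_comparison_test)
  have lower: "Gamma (real n + 3/2) \<le> Gamma (real k + real n + 3/2)" for k
  proof (induction k)
    case (Suc k)
    have "Gamma (real k + real n + 3/2) \<le> (real k + real n + 3/2) * Gamma (real k + real n + 3/2)"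
      using Gamma_half_pos[of k n] by simp
    with Suc show ?case
      unfolding Gamma_half_Suc by linarith
  qed simp
  have "norm (bessel_coeff n k * t^k) \<le> sqrt pi / Gamma (real n + 3/2) * (inverse (fact k) * \<bar>t\<bar>^k)"
    for k
  proof -
    have "Gamma (real n + 3/2) * 1 \<le> Gamma (real k + real n + 3/2) * 2^(2 * k + n + 1)"
      using lower[of k] Gamma_half_pos[of 0 n] by (intro mult_mono) (auto intro: one_le_power simp del: power_Suc power_add)
    then have "fact k * Gamma (real n + 3/2) \<le> fact k * Gamma (real k + real n + 3/2) * 2^(2 * k + n + 1)"
      by (simp add: mult.assoc)
    then have "sqrt pi / (fact k * Gamma (real k + real n + 3/2) * 2^(2 * k + n + 1))
        \<le> sqrt pi / (fact k * Gamma (real n + 3/2))"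
      using Gamma_half_pos[of 0 n] Gamma_half_pos[of k n]
      by (intro divide_left_mono) (auto intro!: mult_pos_pos)
    then have "\<bar>bessel_coeff n k\<bar> \<le> sqrt pi / Gamma (real n + 3/2) * inverse (fact k)"
      using Gamma_half_pos[of k n] by (simp add: bessel_coeff_def abs_mult field_simps)
    from mult_right_mono[OF this, of "\<bar>t\<bar>^k"] show ?thesis
      by (simp add: abs_mult power_abs mult_ac)
  qed
  then show "\<exists>N. \<forall>k\<ge>N. norm (bessel_coeff n k * t^k) \<le>
      sqrt pi / Gamma (real n + 3/2) * (inverse (fact k) * \<bar>t\<bar>^k)"
    by blast
  show "summable (\<lambda>k. sqrt pi / Gamma (real n + 3/2) * (inverse (fact k) * \<bar>t\<bar>^k))"
    by (intro summable_mult summable_exp)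
qed

lemma DERIV_bessel_series:
  "(bessel_series n has_real_derivative - bessel_series (Suc n) t / 2) (at t)"
proof -
  have "(bessel_series n has_real_derivative (\<Sum>k. diffs (bessel_coeff n) k * t^k)) (at t)"
    unfolding bessel_series_def[abs_def]
    by (rule termdiffs_strong_converges_everywhere) (rule summable_bessel)
  moreover have "(\<Sum>k. diffs (bessel_coeff n) k * t^k) = (\<Sum>k. (- 1/2) * (bessel_coeff (Suc n) k * t^k))"
    by (rule suminf_cong) (simp add: diffs_def bessel_coeff_Suc_Suc)
  ultimately show ?thesis
    by (simp only: bessel_series_def suminf_mult[OF summable_bessel]) simp
qed

lemmas DERIV_bessel_series' [derivative_intros] = DERIV_chain2[OF DERIV_bessel_series]

lemma continuous_bessel_series [continuous_intros]:
  "continuous_on A g \<Longrightarrow> continuous_on A (\<lambda>x. bessel_series n (g x))"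
  by (rule continuous_on_compose2[of UNIV "bessel_series n"])
     (auto intro: DERIV_continuous_on DERIV_bessel_series)

text \<open>This is j_n(s) + j_(n+2)(s) = (2n + 3) j_(n+1)(s) / s after division by s^n, with t =
  s^2.\<close>

lemma bessel_series_recurrence:
  "bessel_series n t + t * bessel_series (n + 2) t = (2 * real n + 3) * bessel_series (n + 1) t"
proof -
  have *: "bessel_coeff n k + (if k = 0 then 0 else bessel_coeff (n + 2) (k - 1)) =
      (2 * real n + 3) * bessel_coeff (n + 1) k" for k
  proof (cases k)
    case (Suc l)
    show ?thesis
      unfolding Suc using bessel_coeff_Suc_Suc[of "Suc n" l] bessel_coeff_Suc[of n "Suc l"]
      by (simp add: field_simps)
  qed (use bessel_coeff_Suc[of n 0] in \<open>simp add: field_simps\<close>)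
  have "(\<lambda>k. bessel_coeff (n + 2) k * t^Suc k) sums (t * bessel_series (n + 2) t)"
    using sums_mult[OF summable_sums[OF summable_bessel[of "n + 2" t]], of t]
    by (simp add: bessel_series_def mult_ac)
  then have "(\<lambda>k. (if k = 0 then 0 else bessel_coeff (n + 2) (k - 1)) * t^k) sums (t * bessel_series (n + 2) t)"
    using sums_Suc[of "\<lambda>k. (if k = 0 then 0 else bessel_coeff (n + 2) (k - 1)) * t^k"] by simp
  from sums_add[OF summable_sums[OF summable_bessel[of n t]] this]
  have "(\<lambda>k. (2 * real n + 3) * (bessel_coeff (n + 1) k * t^k)) sums
      (bessel_series n t + t * bessel_series (n + 2) t)"
    unfolding bessel_series_def[of n t] distrib_right[symmetric] * by (simp only: mult.assoc)
  then show ?thesis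
    using sums_mult[OF summable_sums[OF summable_bessel[of "n + 1" t]], of "2 * real n + 3"]
    by (simp add: bessel_series_def sums_iff)
qed

lemma bessel_series_0_square: "s * bessel_series 0 (s\<^sup>2) = sin s"
proof -
  have "(\<lambda>k. s * (bessel_coeff 0 k * (s\<^sup>2)^k)) sums (s * bessel_series 0 (s\<^sup>2))"
    unfolding bessel_series_def by (intro sums_mult summable_sums summable_bessel)
  moreover have "(\<lambda>k. s * (bessel_coeff 0 k * (s\<^sup>2)^k)) = (\<lambda>k. (- 1) ^ k / (fact (2 * k + 1)) * s ^ (2 * k + 1))"
    by (simp add: bessel_coeff_0 power_mult fun_eq_iff)
  ultimately show ?thesis
    using sin_paired[of s] sums_unique2 by metis
qed

lemma bessel_series_at_0: "bessel_series 0 0 = 1"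
  using powser_zero[of "bessel_coeff 0"] by (simp add: bessel_series_def bessel_coeff_0)

text \<open>For s > 0 the power with exponent 2k + n + 1/2 splits into an integer power and a root,
  and the root cancels against the prefactor in \<open>spherical_bessel\<close>. At s = 0 the limit
  values put into the definition are those of the series.\<close>

lemma spherical_bessel_eq:
  assumes "s \<ge> 0"
  shows "spherical_bessel n s = s^n * bessel_series n (s\<^sup>2)"
proof (cases "s = 0")
  case True
  then show ?thesis
    using bessel_series_at_0 by (simp add: spherical_bessel_def power_0_left)
next
  case False
  with assms have s: "s > 0" by simp
  have "(-1)^k / (fact k * Gamma (real k + (real n + 1/2) + 1)) * (s / 2) powr (2 * real k + (real n + 1/2))
     = (sqrt (2 * s) / sqrt pi * s^n) * (bessel_coeff n k * (s\<^sup>2)^k)" (is "?l k = _") for k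
  proof -
    have "(s / 2) powr (2 * real k + (real n + 1/2)) = (s / 2) powr (real (2 * k + n)) * (s/2) powr (1/2)"
      by (simp add: powr_add[symmetric] add_ac)
    also have "\<dots> = (s / 2) ^ (2 * k + n) * sqrt (s / 2)"
      using s by (subst powr_realpow) (auto simp: powr_half_sqrt)
    also have "sqrt (s / 2) = sqrt (2 * s) / 2"
      by (rule real_sqrt_unique) (use s in \<open>auto simp: power_divide\<close>)
    finally have powr: "(s / 2) powr (2 * real k + (real n + 1/2)) = (s / 2) ^ (2 * k + n) * (sqrt (2 * s) / 2)" .
    define G where "G = Gamma (real k + real n + 3/2)"
    have "Gamma (real k + (real n + 1/2) + 1) = G" "G > 0"
      using Gamma_half_pos[of k n] by (simp_all add: G_def add_ac)
    then show ?thesis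
      unfolding powr bessel_coeff_def G_def[symmetric]
      by (simp add: power_add power_mult power_divide power2_eq_square power_mult_distrib field_simps)
  qed
  then have "bessel_J (real n + 1/2) s = (sqrt (2 * s) / sqrt pi * s^n) * bessel_series n (s\<^sup>2)"
    by (simp only: bessel_J_def bessel_series_def suminf_mult[OF summable_bessel])
  moreover have "sqrt (pi / (2 * s)) * (sqrt (2 * s) / sqrt pi) = 1"
    using s by (simp add: real_sqrt_divide)
  ultimately show ?thesis
    using False unfolding spherical_bessel_def by (simp add: mult.assoc[symmetric])
qed

section \<open>Plane waves on the sphere\<close>

lemma has_vector_derivative_cis:
  assumes "(g has_real_derivative g') (at x within A)"
  shows "((\<lambda>x. cis (g x)) has_vector_derivative g' *\<^sub>R (\<i> * cis (g x))) (at x within A)"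
proof -
  have "(g has_derivative (\<lambda>h. h * g')) (at x within A)"
    using assms by (simp add: has_field_derivative_def mult_commute_abs)
  from has_derivative_cis[OF this] show ?thesis
    by (simp add: has_vector_derivative_def)
qed

text \<open>Each summand integrates to zero along its own variable by the fundamental theorem of
  calculus, because the boundary values agree; continuity permits either order of
  integration.\<close>

lemma integral_divergence_eq_0:
  fixes P Q P' Q' :: "real \<Rightarrow> real \<Rightarrow> complex"
  assumes le: "a \<le> b" "c \<le> d"
    and P: "\<And>x y. ((\<lambda>x. P x y) has_vector_derivative P' x y) (at x)"
    and Q: "\<And>x y. ((\<lambda>y. Q x y) has_vector_derivative Q' x y) (at y)"
    and contP: "continuous_on UNIV (\<lambda>(x, y). P' x y)"
    and contQ: "continuous_on UNIV (\<lambda>(x, y). Q' x y)"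
    and bdP: "\<And>y. P a y = P b y" and bdQ: "\<And>x. Q x c = Q x d"
  shows "integral (cbox (a, c) (b, d)) (\<lambda>(x, y). P' x y + Q' x y) = 0"
proof -
  note cP = continuous_on_subset[OF contP subset_UNIV]
  note cQ = continuous_on_subset[OF contQ subset_UNIV]
  have P0: "integral {a..b} (\<lambda>x. P' x y) = 0" for y
    using fundamental_theorem_of_calculus[OF le(1), of "\<lambda>x. P x y" "\<lambda>x. P' x y"] P bdP
    by (auto intro!: integral_unique simp: has_vector_derivative_at_within)
  have Q0: "integral {c..d} (\<lambda>y. Q' x y) = 0" for x
    using fundamental_theorem_of_calculus[OF le(2), of "\<lambda>y. Q x y" "\<lambda>y. Q' x y"] Q bdQ
    by (auto intro!: integral_unique simp: has_vector_derivative_at_within)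
  have "integral (cbox (a, c) (b, d)) (\<lambda>(x, y). P' x y + Q' x y) =
      integral (cbox (a, c) (b, d)) (\<lambda>(x, y). P' x y) + integral (cbox (a, c) (b, d)) (\<lambda>(x, y). Q' x y)"
    unfolding split_beta
    by (rule integral_add) (use cP cQ in \<open>auto intro!: integrable_continuous simp: split_beta\<close>)
  also have "integral (cbox (a, c) (b, d)) (\<lambda>(x, y). P' x y) = 0"
    using integral_swap_continuous[OF cP[of "cbox (a, c) (b, d)"]]
    by (simp add: integral_prod_continuous[OF cP] P0)
  also have "integral (cbox (a, c) (b, d)) (\<lambda>(x, y). Q' x y) = 0"
    by (subst integral_prod_continuous[OF cQ]) (simp add: Q0)
  finally show ?thesis by simp
qed

text \<open>The cosine of the angle between the directions with spherical coordinates
  \<open>(\<beta>, \<alpha>)\<close> and \<open>(\<phi>, \<theta>)\<close>.\<close>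
definition angle_cos :: "real \<Rightarrow> real \<Rightarrow> real \<Rightarrow> real \<Rightarrow> real" where
  "angle_cos \<alpha> \<beta> \<theta> \<phi> = cos \<alpha> * cos \<theta> + sin \<alpha> * sin \<theta> * cos (\<phi> - \<beta>)"

lemma inner_vec3: "(x::vec3) \<bullet> y = x $ (-1) * y $ (-1) + x $ 0 * y $ 0 + x $ 1 * y $ 1"
  by (simp add: inner_vec_def sum_index)

lemma inner_spherical: "spherical \<rho> \<phi> \<theta> \<bullet> spherical s \<beta> \<alpha> = \<rho> * s * angle_cos \<alpha> \<beta> \<theta> \<phi>"
  by (simp add: inner_vec3 spherical_def angle_cos_def cos_diff algebra_simps)

text \<open>\<open>polar_Ex\<close> fixes no sign, so s may be negative; only s^2 matters for the
  value of the mean.\<close>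

lemma ex_spherical: "\<exists>s \<beta> \<alpha>. r = spherical s \<beta> \<alpha>"
proof -
  obtain R \<beta> where R: "r $ 1 = R * cos \<beta>" "r $ (-1) = R * sin \<beta>"
    using polar_Ex by blast
  obtain s \<alpha> where "r $ 0 = s * cos \<alpha>" "R = s * sin \<alpha>"
    using polar_Ex by blast
  with R have "r = spherical s \<beta> \<alpha>"
    by (simp add: vec_eq_iff forall_index spherical_def)
  then show ?thesis by blast
qed

lemma norm_spherical: "norm (spherical \<rho> \<phi> \<theta>) = \<bar>\<rho>\<bar>"
  using inner_spherical[of \<rho> \<phi> \<theta> \<rho> \<phi> \<theta>]
  by (simp add: norm_eq_sqrt_inner angle_cos_def power2_eq_square[symmetric])

lemma continuous_spherical [continuous_intros]:
  fixes A :: "'a::t2_space set"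
  assumes "continuous_on A f" "continuous_on A g" "continuous_on A h"
  shows "continuous_on A (\<lambda>x. spherical (f x) (g x) (h x))"
  unfolding spherical_def
proof (rule continuous_on_vec_lambda)
  fix i :: 3
  show "continuous_on A (\<lambda>x. if i = - 1 then f x * sin (h x) * sin (g x)
      else if i = 0 then f x * cos (h x) else f x * sin (h x) * cos (g x))"
    by (cases "i = -1"; cases "i = 0") (auto intro!: continuous_intros assms)
qed

abbreviation sphere_box :: "(real \<times> real) set" where
  "sphere_box \<equiv> cbox (0, 0) (pi, 2 * pi)"

definition plane_wave_integral :: "real \<Rightarrow> real \<Rightarrow> real \<Rightarrow> complex" where
  "plane_wave_integral s \<alpha> \<beta> =
     integral sphere_box (\<lambda>(\<theta>, \<phi>). sin \<theta> *\<^sub>R cis (s * angle_cos \<alpha> \<beta> \<theta> \<phi>))"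

text \<open>Only \<phi> - \<beta> enters, so the derivative in \<beta> is minus the derivative in
  \<phi>, whose integral over a full period vanishes.\<close>

lemma plane_wave_integral_azimuth: "plane_wave_integral s \<alpha> \<beta> = plane_wave_integral s \<alpha> 0"
proof -
  have "((\<lambda>\<beta>. plane_wave_integral s \<alpha> \<beta>) has_vector_derivative 0) (at \<beta>)" for \<beta>
  proof -
    define t' where "t' = (\<lambda>\<beta> \<theta> \<phi> :: real. sin \<alpha> * sin \<theta> * sin (\<phi> - \<beta>))"
    have "((\<lambda>\<beta>. plane_wave_integral s \<alpha> \<beta>) has_vector_derivative
        integral sphere_box (\<lambda>(\<theta>, \<phi>). sin \<theta> *\<^sub>R
          ((s * t' \<beta> \<theta> \<phi>) *\<^sub>R (\<i> * cis (s * angle_cos \<alpha> \<beta> \<theta> \<phi>))))) (at \<beta> within UNIV)"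
      unfolding plane_wave_integral_def
    proof (rule leibniz_rule_vector_derivative)
      fix \<beta> and x :: "real \<times> real"
      obtain \<theta> \<phi> where x: "x = (\<theta>, \<phi>)" by fastforce
      have "((\<lambda>\<beta>. s * angle_cos \<alpha> \<beta> \<theta> \<phi>) has_real_derivative s * t' \<beta> \<theta> \<phi>) (at \<beta>)"
        unfolding angle_cos_def t'_def by (auto intro!: derivative_eq_intros)
      from has_vector_derivative_scaleR[OF DERIV_const has_vector_derivative_cis[OF this]]
      show "((\<lambda>\<beta>. case x of (\<theta>, \<phi>) \<Rightarrow> sin \<theta> *\<^sub>R cis (s * angle_cos \<alpha> \<beta> \<theta> \<phi>)) has_vector_derivative
          (case x of (\<theta>, \<phi>) \<Rightarrow> sin \<theta> *\<^sub>R ((s * t' \<beta> \<theta> \<phi>) *\<^sub>R (\<i> * cis (s * angle_cos \<alpha> \<beta> \<theta> \<phi>)))))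
          (at \<beta> within UNIV)"
        by (simp add: x)
    qed (auto simp: split_beta t'_def angle_cos_def intro!: integrable_continuous continuous_intros)
    also have "integral sphere_box (\<lambda>(\<theta>, \<phi>). sin \<theta> *\<^sub>R
          ((s * t' \<beta> \<theta> \<phi>) *\<^sub>R (\<i> * cis (s * angle_cos \<alpha> \<beta> \<theta> \<phi>)))) =
        integral sphere_box (\<lambda>(\<theta>, \<phi>). 0 + sin \<theta> *\<^sub>R
          ((s * t' \<beta> \<theta> \<phi>) *\<^sub>R (\<i> * cis (s * angle_cos \<alpha> \<beta> \<theta> \<phi>))))"
      by simp
    also have "\<dots> = 0"
    proof (rule integral_divergence_eq_0)
      fix \<theta> \<phi>
      have "((\<lambda>\<phi>. s * angle_cos \<alpha> \<beta> \<theta> \<phi>) has_real_derivative - s * t' \<beta> \<theta> \<phi>) (at \<phi>)"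
        unfolding angle_cos_def t'_def by (auto intro!: derivative_eq_intros)
      from has_vector_derivative_scaleR[OF DERIV_const[of "- sin \<theta>"] has_vector_derivative_cis[OF this]]
      show "((\<lambda>\<phi>. - sin \<theta> *\<^sub>R cis (s * angle_cos \<alpha> \<beta> \<theta> \<phi>)) has_vector_derivative
          sin \<theta> *\<^sub>R ((s * t' \<beta> \<theta> \<phi>) *\<^sub>R (\<i> * cis (s * angle_cos \<alpha> \<beta> \<theta> \<phi>)))) (at \<phi>)"
        by simp
      have "cos (0 - \<beta>) = cos (2 * pi - \<beta>)"
        by (simp add: cos_diff)
      then show "- sin \<theta> *\<^sub>R cis (s * angle_cos \<alpha> \<beta> \<theta> 0) = - sin \<theta> *\<^sub>R cis (s * angle_cos \<alpha> \<beta> \<theta> (2 * pi))"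
        by (simp add: angle_cos_def)
      show "((\<lambda>x. 0) has_vector_derivative 0) (at \<theta>)"
        by simp
    qed (auto simp: split_beta t'_def angle_cos_def intro!: continuous_intros)
    finally show ?thesis by simp
  qed
  then show ?thesis
    using has_vector_derivative_zero_constant[of UNIV "plane_wave_integral s \<alpha>"] by (metis UNIV_I convex_UNIV)
qed

text \<open>The derivative in \<open>\<alpha>\<close> is the integral of the derivative along the rotation field
  \<open>- cos \<phi> \<partial>\<^sub>\<theta> + cot \<theta> sin \<phi> \<partial>\<^sub>\<phi>\<close> on the sphere; multiplied by
  \<open>sin \<theta>\<close>, it is the divergence of a pair \<open>(P, Q)\<close> with equal values on opposite sides of the box.\<close>
lemma plane_wave_integral_polar: "plane_wave_integral s \<alpha> 0 = plane_wave_integral s 0 0"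
proof -
  have "((\<lambda>\<alpha>. plane_wave_integral s \<alpha> 0) has_vector_derivative 0) (at \<alpha>)" for \<alpha>
  proof -
    define t' where "t' = (\<lambda>\<alpha> \<theta> \<phi> :: real. - sin \<alpha> * cos \<theta> + cos \<alpha> * sin \<theta> * cos \<phi>)"
    have "((\<lambda>\<alpha>. plane_wave_integral s \<alpha> 0) has_vector_derivative
        integral sphere_box (\<lambda>(\<theta>, \<phi>). sin \<theta> *\<^sub>R
          ((s * t' \<alpha> \<theta> \<phi>) *\<^sub>R (\<i> * cis (s * angle_cos \<alpha> 0 \<theta> \<phi>))))) (at \<alpha> within UNIV)"
      unfolding plane_wave_integral_def
    proof (rule leibniz_rule_vector_derivative)
      fix \<alpha> and x :: "real \<times> real"
      obtain \<theta> \<phi> where x: "x = (\<theta>, \<phi>)" by fastforce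
      have "((\<lambda>\<alpha>. s * angle_cos \<alpha> 0 \<theta> \<phi>) has_real_derivative s * t' \<alpha> \<theta> \<phi>) (at \<alpha>)"
        unfolding angle_cos_def t'_def by (auto intro!: derivative_eq_intros)
      from has_vector_derivative_scaleR[OF DERIV_const has_vector_derivative_cis[OF this]]
      show "((\<lambda>\<alpha>. case x of (\<theta>, \<phi>) \<Rightarrow> sin \<theta> *\<^sub>R cis (s * angle_cos \<alpha> 0 \<theta> \<phi>)) has_vector_derivative
          (case x of (\<theta>, \<phi>) \<Rightarrow> sin \<theta> *\<^sub>R ((s * t' \<alpha> \<theta> \<phi>) *\<^sub>R (\<i> * cis (s * angle_cos \<alpha> 0 \<theta> \<phi>)))))
          (at \<alpha> within UNIV)"
        by (simp add: x)
    qed (auto simp: split_beta t'_def angle_cos_def intro!: integrable_continuous continuous_intros)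
    \<comment> \<open>The last terms of \<open>P'\<close> and \<open>Q'\<close> are derivatives of
      the prefactors - sin \<theta> cos \<phi> and cos \<theta> sin \<phi>. They cancel in the sum,
      and the prefactors vanish on the relevant sides of the box.\<close>
    also define P' where "P' = (\<lambda>\<theta> \<phi>. (- (sin \<theta> * cos \<phi>)) *\<^sub>R
        ((s * (- cos \<alpha> * sin \<theta> + sin \<alpha> * cos \<theta> * cos \<phi>)) *\<^sub>R (\<i> * cis (s * angle_cos \<alpha> 0 \<theta> \<phi>)))
        + (- (cos \<theta> * cos \<phi>)) *\<^sub>R cis (s * angle_cos \<alpha> 0 \<theta> \<phi>))"
    define Q' where "Q' = (\<lambda>\<theta> \<phi>. (cos \<theta> * sin \<phi>) *\<^sub>R
        ((s * (- sin \<alpha> * sin \<theta> * sin \<phi>)) *\<^sub>R (\<i> * cis (s * angle_cos \<alpha> 0 \<theta> \<phi>)))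
        + (cos \<theta> * cos \<phi>) *\<^sub>R cis (s * angle_cos \<alpha> 0 \<theta> \<phi>))"
    have "sin \<theta> *\<^sub>R ((s * t' \<alpha> \<theta> \<phi>) *\<^sub>R (\<i> * cis (s * angle_cos \<alpha> 0 \<theta> \<phi>))) = P' \<theta> \<phi> + Q' \<theta> \<phi>"
      for \<theta> \<phi>
    proof -
      have "sin \<theta> * t' \<alpha> \<theta> \<phi> =
          - (sin \<theta> * cos \<phi>) * (- cos \<alpha> * sin \<theta> + sin \<alpha> * cos \<theta> * cos \<phi>)
          + cos \<theta> * sin \<phi> * (- sin \<alpha> * sin \<theta> * sin \<phi>)"
        using sin_cos_squared_add[of \<phi>] unfolding t'_def by algebra
      then have "sin \<theta> * (s * t' \<alpha> \<theta> \<phi>) =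
          - (sin \<theta> * cos \<phi>) * (s * (- cos \<alpha> * sin \<theta> + sin \<alpha> * cos \<theta> * cos \<phi>))
          + cos \<theta> * sin \<phi> * (s * (- sin \<alpha> * sin \<theta> * sin \<phi>))"
        by algebra
      then show ?thesis
        unfolding P'_def Q'_def scaleR_scaleR by (simp only: scaleR_add_left scaleR_minus_left) simp
    qed
    then have "integral sphere_box (\<lambda>(\<theta>, \<phi>). sin \<theta> *\<^sub>R
          ((s * t' \<alpha> \<theta> \<phi>) *\<^sub>R (\<i> * cis (s * angle_cos \<alpha> 0 \<theta> \<phi>)))) =
        integral sphere_box (\<lambda>(\<theta>, \<phi>). P' \<theta> \<phi> + Q' \<theta> \<phi>)"
      by simp
    also have "\<dots> = 0"
    proof (rule integral_divergence_eq_0)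
      fix \<theta> \<phi>
      have d: "((\<lambda>\<theta>. s * angle_cos \<alpha> 0 \<theta> \<phi>) has_real_derivative
          s * (- cos \<alpha> * sin \<theta> + sin \<alpha> * cos \<theta> * cos \<phi>)) (at \<theta>)"
        unfolding angle_cos_def by (auto intro!: derivative_eq_intros)
      have "((\<lambda>\<theta>. - (sin \<theta> * cos \<phi>)) has_real_derivative - (cos \<theta> * cos \<phi>)) (at \<theta>)"
        by (auto intro!: derivative_eq_intros)
      from has_vector_derivative_scaleR[OF this has_vector_derivative_cis[OF d]]
      show "((\<lambda>\<theta>. (- (sin \<theta> * cos \<phi>)) *\<^sub>R cis (s * angle_cos \<alpha> 0 \<theta> \<phi>)) has_vector_derivative P' \<theta> \<phi>) (at \<theta>)"
        by (simp add: P'_def)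
      have d: "((\<lambda>\<phi>. s * angle_cos \<alpha> 0 \<theta> \<phi>) has_real_derivative
          s * (- sin \<alpha> * sin \<theta> * sin \<phi>)) (at \<phi>)"
        unfolding angle_cos_def by (auto intro!: derivative_eq_intros)
      have "((\<lambda>\<phi>. cos \<theta> * sin \<phi>) has_real_derivative cos \<theta> * cos \<phi>) (at \<phi>)"
        by (auto intro!: derivative_eq_intros)
      from has_vector_derivative_scaleR[OF this has_vector_derivative_cis[OF d]]
      show "((\<lambda>\<phi>. (cos \<theta> * sin \<phi>) *\<^sub>R cis (s * angle_cos \<alpha> 0 \<theta> \<phi>)) has_vector_derivative Q' \<theta> \<phi>) (at \<phi>)"
        by (simp add: Q'_def)
    qed (auto simp: split_beta P'_def Q'_def angle_cos_def intro!: continuous_intros)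
    finally show ?thesis by simp
  qed
  then show ?thesis
    using has_vector_derivative_zero_constant[of UNIV "\<lambda>\<alpha>. plane_wave_integral s \<alpha> 0"]
    by (metis UNIV_I convex_UNIV)
qed

text \<open>With r on the polar axis the phase depends on \<theta> alone, and the factor sin
  \<theta> turns the integrand into a derivative; s = 0 is separate because the antiderivative
  contains 1 / s.\<close>

lemma plane_wave_integral_eq: "plane_wave_integral s \<alpha> \<beta> = (4 * pi) *\<^sub>R complex_of_real (bessel_series 0 (s\<^sup>2))"
proof -
  have *: "integral {0..pi} (\<lambda>\<theta>. sin \<theta> *\<^sub>R cis (s * cos \<theta>)) = 2 *\<^sub>R complex_of_real (bessel_series 0 (s\<^sup>2))"
  proof (cases "s = 0")
    case True
    have "((\<lambda>\<theta>. complex_of_real (sin \<theta>)) has_integral (complex_of_real (- cos pi) - complex_of_real (- cos 0))) {0..pi}"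
      by (intro fundamental_theorem_of_calculus has_vector_derivative_of_real)
         (auto intro!: derivative_eq_intros simp: has_real_derivative_iff_has_vector_derivative[symmetric])
    from integral_unique[OF this] show ?thesis
      using True by (simp add: bessel_series_at_0 scaleR_conv_of_real)
  next
    case False
    have "((\<lambda>\<theta>. sin \<theta> *\<^sub>R cis (s * cos \<theta>)) has_integral
        ((\<i> / s) * cis (s * cos pi) - (\<i> / s) * cis (s * cos 0))) {0..pi}"
    proof (rule fundamental_theorem_of_calculus)
      fix \<theta> :: real assume "\<theta> \<in> {0..pi}"
      have "((\<lambda>\<theta>. s * cos \<theta>) has_real_derivative - s * sin \<theta>) (at \<theta> within {0..pi})"
        by (auto intro!: derivative_eq_intros)
      note has_vector_derivative_mult_right[OF has_vector_derivative_cis[OF this], of "\<i> / s"]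
      also have "\<i> / s * ((- s * sin \<theta>) *\<^sub>R (\<i> * cis (s * cos \<theta>))) = sin \<theta> *\<^sub>R cis (s * cos \<theta>)"
        using False by (simp add: complex_eq_iff)
      finally
      show "((\<lambda>\<theta>. (\<i> / s) * cis (s * cos \<theta>)) has_vector_derivative sin \<theta> *\<^sub>R cis (s * cos \<theta>))
          (at \<theta> within {0..pi})" .
    qed simp
    moreover have "(\<i> / s) * cis (s * cos pi) - (\<i> / s) * cis (s * cos 0) =
        2 *\<^sub>R complex_of_real (bessel_series 0 (s\<^sup>2))"
      using False bessel_series_0_square[of s]
      by (simp add: complex_eq_iff field_simps)
    ultimately show ?thesis
      by (simp add: integral_unique)
  qed
  have "plane_wave_integral s 0 0 = 2 * pi * integral {0..pi} (\<lambda>\<theta>. sin \<theta> *\<^sub>R cis (s * cos \<theta>))"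
    unfolding plane_wave_integral_def
    by (subst integral_prod_continuous)
       (auto simp: angle_cos_def split_beta scaleR_conv_of_real mult.assoc simp flip: integral_mult_right
             intro!: continuous_intros)
  then show ?thesis
    unfolding plane_wave_integral_azimuth[of s \<alpha> \<beta>] plane_wave_integral_polar[of s \<alpha>] *
    by (simp add: scaleR_conv_of_real)
qed

section \<open>Moments of a plane wave\<close>

text \<open>The mean over the unit sphere of w(\<omega>) exp(i(\<omega>,r)), 4 pi being the area.
  Written with \<open>has_integral\<close>, it carries integrability through sums and
  multiples.\<close>

definition has_sphere_avg :: "(vec3 \<Rightarrow> real) \<Rightarrow> vec3 \<Rightarrow> complex \<Rightarrow> bool" where
  "has_sphere_avg w r v \<longleftrightarrow>
     ((\<lambda>(\<theta>, \<phi>). (sin \<theta> * w (spherical 1 \<phi> \<theta>)) *\<^sub>R cis (spherical 1 \<phi> \<theta> \<bullet> r))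
        has_integral (4 * pi) *\<^sub>R v) sphere_box"

lemma has_sphere_avg_add:
  "has_sphere_avg w r v \<Longrightarrow> has_sphere_avg w' r v' \<Longrightarrow> has_sphere_avg (\<lambda>\<omega>. w \<omega> + w' \<omega>) r (v + v')"
  unfolding has_sphere_avg_def case_prod_unfold
  by (drule (1) has_integral_add) (simp add: algebra_simps)

lemma has_sphere_avg_cmul: "has_sphere_avg w r v \<Longrightarrow> has_sphere_avg (\<lambda>\<omega>. c * w \<omega>) r (c * v)"
  unfolding has_sphere_avg_def case_prod_unfold
  by (drule has_integral_cmul[of _ _ _ c]) (simp add: algebra_simps scaleR_conv_of_real)

lemma has_sphere_avg_sum:
  "finite A \<Longrightarrow> (\<And>q. q \<in> A \<Longrightarrow> has_sphere_avg (w q) r (v q)) \<Longrightarrow>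
    has_sphere_avg (\<lambda>\<omega>. \<Sum>q\<in>A. w q \<omega>) r (\<Sum>q\<in>A. v q)"
  by (induction A rule: finite_induct)
     (simp_all add: has_sphere_avg_add, simp add: has_sphere_avg_def case_prod_unfold)

lemma has_sphere_avg_cong:
  assumes "has_sphere_avg w r v" "\<And>\<omega>. norm \<omega> = 1 \<Longrightarrow> w' \<omega> = w \<omega>" "v' = v"
  shows "has_sphere_avg w' r v'"
  using assms by (simp add: has_sphere_avg_def norm_spherical)

lemma has_sphere_avg_1: "has_sphere_avg (\<lambda>_. 1) r (bessel_series 0 ((norm r)\<^sup>2))"
proof -
  obtain s \<beta> \<alpha> where r: "r = spherical s \<beta> \<alpha>"
    using ex_spherical by blast
  have "(\<lambda>(\<theta>, \<phi>). sin \<theta> *\<^sub>R cis (s * angle_cos \<alpha> \<beta> \<theta> \<phi>)) integrable_on sphere_box"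
    by (auto simp: split_beta angle_cos_def intro!: integrable_continuous continuous_intros)
  from integrable_integral[OF this] show ?thesis
    unfolding has_sphere_avg_def plane_wave_integral_def[symmetric] plane_wave_integral_eq
    by (simp add: r inner_spherical norm_spherical)
qed

text \<open>Differentiating exp(i(\<omega>,r)) along the axis j produces the factor i \<omega>_j,
  and multiplying by - i leaves the moment. The constant \<open>c\<close> holds the powers of i, so
  that \<open>G\<close> stays real.\<close>

lemma has_sphere_avg_coordinate:
  assumes cont: "continuous_on UNIV w"
    and avg: "\<And>r. has_sphere_avg w r (c * of_real (G r))"
    and deriv: "((\<lambda>t. G (r + t *\<^sub>R axis j 1)) has_real_derivative D) (at 0)"
  shows "has_sphere_avg (\<lambda>\<omega>. w \<omega> * \<omega> $ j) r (- \<i> * c * D)"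
proof -
  define f where "f = (\<lambda>t (\<theta>, \<phi>). (sin \<theta> * w (spherical 1 \<phi> \<theta>)) *\<^sub>R
      cis (spherical 1 \<phi> \<theta> \<bullet> (r + t *\<^sub>R axis j 1)))"
  define f' where "f' = (\<lambda>t (\<theta>, \<phi>). (sin \<theta> * w (spherical 1 \<phi> \<theta>)) *\<^sub>R
      (spherical 1 \<phi> \<theta> $ j *\<^sub>R (\<i> * cis (spherical 1 \<phi> \<theta> \<bullet> (r + t *\<^sub>R axis j 1)))))"
  have w: "continuous_on A (\<lambda>x. w (g x))" if "continuous_on A g" for A :: "'a::topological_space set" and g
    by (rule continuous_on_compose2[OF cont that]) simp
  have cont_f: "continuous_on sphere_box (f t)" for t
    unfolding f_def split_beta by (intro continuous_intros w)
  have cont_f': "continuous_on (UNIV \<times> sphere_box) (\<lambda>(t, x). f' t x)"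
    unfolding f'_def split_beta by (intro continuous_intros w)
  have "((\<lambda>t. integral sphere_box (f t)) has_vector_derivative integral sphere_box (f' 0)) (at 0 within UNIV)"
  proof (rule leibniz_rule_vector_derivative)
    fix t and x :: "real \<times> real"
    obtain \<theta> \<phi> where x: "x = (\<theta>, \<phi>)" by fastforce
    have "((\<lambda>t. spherical 1 \<phi> \<theta> \<bullet> (r + t *\<^sub>R axis j 1)) has_real_derivative spherical 1 \<phi> \<theta> $ j) (at t)"
      by (auto intro!: derivative_eq_intros simp: inner_add_right inner_axis)
    from has_vector_derivative_scaleR[OF DERIV_const has_vector_derivative_cis[OF this]]
    show "((\<lambda>t. f t x) has_vector_derivative f' t x) (at t within UNIV)"
      by (simp add: x f_def f'_def)
  qed (use cont_f' in \<open>auto intro: integrable_continuous cont_f\<close>)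
  moreover have "integral sphere_box (f t) = (4 * pi) *\<^sub>R (c * of_real (G (r + t *\<^sub>R axis j 1)))" for t
    using avg[of "r + t *\<^sub>R axis j 1"] unfolding has_sphere_avg_def f_def by (rule integral_unique)
  moreover have "((\<lambda>t. (4 * pi) *\<^sub>R (c * of_real (G (r + t *\<^sub>R axis j 1)))) has_vector_derivative
      (4 * pi) *\<^sub>R (c * of_real D)) (at 0)"
    using deriv by (auto intro!: derivative_eq_intros has_vector_derivative_of_real
        simp: has_real_derivative_iff_has_vector_derivative)
  ultimately have "integral sphere_box (f' 0) = (4 * pi) *\<^sub>R (c * of_real D)"
    using vector_derivative_unique_at by simp
  moreover have "f' 0 integrable_on sphere_box"
    unfolding f'_def split_beta by (intro integrable_continuous continuous_intros w)
  ultimately have "(f' 0 has_integral (4 * pi) *\<^sub>R (c * of_real D)) sphere_box"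
    by (metis integrable_integral)
  from has_integral_mult_right[OF this, of "- \<i>"] show ?thesis
    by (simp add: has_sphere_avg_def f'_def case_prod_unfold scaleR_conv_of_real mult_ac)
qed

lemma DERIV_coordinate: "((\<lambda>t. (r + t *\<^sub>R axis j 1) $ k) has_real_derivative kron j k) (at 0)"
  by (auto intro!: derivative_eq_intros simp: kron_def axis_def)

text \<open>|r + t e_j|^2 has derivative 2 r_j at t = 0, and the 2 cancels the 1/2 in b_n' = -
  b_(n+1) / 2.\<close>

lemma DERIV_bessel_series_norm:
  "((\<lambda>t. bessel_series n ((norm (r + t *\<^sub>R axis j 1))\<^sup>2)) has_real_derivative
     - r $ j * bessel_series (Suc n) ((norm r)\<^sup>2)) (at 0)"
proof -
  have "(norm (r + t *\<^sub>R axis j 1))\<^sup>2 = (norm r)\<^sup>2 + 2 * t * r $ j + t\<^sup>2" for t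
    unfolding power2_norm_eq_inner
    by (simp add: inner_add_left inner_add_right inner_axis inner_axis' power2_eq_square algebra_simps)
  then show ?thesis
    by (auto intro!: derivative_eq_intros)
qed

lemmas DERIV_moment =
  DERIV_coordinate DERIV_bessel_series_norm DERIV_minus DERIV_add DERIV_diff DERIV_mult DERIV_const

lemma continuous_coordinate: "continuous_on UNIV (\<lambda>\<omega>::vec3. \<omega> $ j)"
  by (intro continuous_intros)

text \<open>The moments of order k are (- i)^k times partial derivatives of b_0(|r|^2). Each
  derivative hits either a coordinate of r, leaving a Kronecker delta, or a Bessel factor, raising
  its index and contributing - r_j.\<close>

lemma has_sphere_avg_moment1:
  "has_sphere_avg (\<lambda>\<omega>. \<omega> $ j) r (\<i> * of_real (r $ j * bessel_series 1 ((norm r)\<^sup>2)))"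
proof -
  have "has_sphere_avg (\<lambda>\<omega>. 1 * \<omega> $ j) r (- \<i> * 1 * of_real (- r $ j * bessel_series (Suc 0) ((norm r)\<^sup>2)))"
    by (rule has_sphere_avg_coordinate[OF _ _ DERIV_bessel_series_norm])
       (auto intro: has_sphere_avg_1)
  then show ?thesis by simp
qed

lemma has_sphere_avg_moment2:
  "has_sphere_avg (\<lambda>\<omega>. \<omega> $ j * \<omega> $ k) r
     (of_real (kron j k * bessel_series 1 ((norm r)\<^sup>2) - r $ j * r $ k * bessel_series 2 ((norm r)\<^sup>2)))"
proof -
  have "((\<lambda>t. (r + t *\<^sub>R axis k 1) $ j * bessel_series 1 ((norm (r + t *\<^sub>R axis k 1))\<^sup>2)) has_real_derivative
      kron j k * bessel_series 1 ((norm r)\<^sup>2) - r $ j * r $ k * bessel_series 2 ((norm r)\<^sup>2)) (at 0)"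
    by (rule DERIV_cong, (rule DERIV_moment)+) (simp add: numeral_eq_Suc kron_def)
  from has_sphere_avg_coordinate[OF continuous_coordinate has_sphere_avg_moment1 this]
  show ?thesis by (simp add: mult.assoc[symmetric])
qed

lemma has_sphere_avg_moment3:
  "has_sphere_avg (\<lambda>\<omega>. \<omega> $ j * \<omega> $ k * \<omega> $ l) r (\<i> * of_real
     ((kron j k * r $ l + kron j l * r $ k + kron k l * r $ j) * bessel_series 2 ((norm r)\<^sup>2)
       - r $ j * r $ k * r $ l * bessel_series 3 ((norm r)\<^sup>2)))"
proof -
  have "((\<lambda>t. kron j k * bessel_series 1 ((norm (r + t *\<^sub>R axis l 1))\<^sup>2)
        - (r + t *\<^sub>R axis l 1) $ j * (r + t *\<^sub>R axis l 1) $ k * bessel_series 2 ((norm (r + t *\<^sub>R axis l 1))\<^sup>2))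
      has_real_derivative
      - ((kron j k * r $ l + kron j l * r $ k + kron k l * r $ j) * bessel_series 2 ((norm r)\<^sup>2)
       - r $ j * r $ k * r $ l * bessel_series 3 ((norm r)\<^sup>2))) (at 0)"
    by (rule DERIV_cong, (rule DERIV_moment)+) (simp add: numeral_eq_Suc kron_def algebra_simps)
  from has_sphere_avg_coordinate[of "\<lambda>\<omega>. \<omega> $ j * \<omega> $ k" 1, OF _ _ this]
  show ?thesis using has_sphere_avg_moment2[of j k]
    by (simp add: continuous_intros del: of_real_add of_real_diff of_real_mult of_real_minus)
       (simp add: algebra_simps)
qed

text \<open>Four indices admit three pairings into two deltas and six choices of a single delta,
  which gives the two symmetric groups of terms.\<close>

lemma has_sphere_avg_moment4:
  "has_sphere_avg (\<lambda>\<omega>. \<omega> $ i * \<omega> $ j * \<omega> $ k * \<omega> $ l) r (of_real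
     ((kron i j * kron k l + kron i k * kron j l + kron i l * kron j k) * bessel_series 2 ((norm r)\<^sup>2)
      - (kron i j * (r $ k * r $ l) + kron i k * (r $ j * r $ l) + kron i l * (r $ j * r $ k)
         + kron j k * (r $ i * r $ l) + kron j l * (r $ i * r $ k) + kron k l * (r $ i * r $ j))
          * bessel_series 3 ((norm r)\<^sup>2)
      + r $ i * r $ j * r $ k * r $ l * bessel_series 4 ((norm r)\<^sup>2)))"
    (is "has_sphere_avg _ _ (of_real ?D)")
proof -
  have "((\<lambda>t. (kron i j * (r + t *\<^sub>R axis l 1) $ k + kron i k * (r + t *\<^sub>R axis l 1) $ j
            + kron j k * (r + t *\<^sub>R axis l 1) $ i) * bessel_series 2 ((norm (r + t *\<^sub>R axis l 1))\<^sup>2)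
       - (r + t *\<^sub>R axis l 1) $ i * (r + t *\<^sub>R axis l 1) $ j * (r + t *\<^sub>R axis l 1) $ k
         * bessel_series 3 ((norm (r + t *\<^sub>R axis l 1))\<^sup>2)) has_real_derivative ?D) (at 0)"
    by (rule DERIV_cong, (rule DERIV_moment)+) (simp add: numeral_eq_Suc kron_def algebra_simps)
  from has_sphere_avg_coordinate[OF _ has_sphere_avg_moment3 this]
  show ?thesis by (simp add: continuous_intros mult.assoc[symmetric])
qed

section \<open>Averages of the rotated vertices\<close>

text \<open>Row \<open>n\<close> expresses the rotated tensor with matrix \<open>D\<^sup>n\<close> in terms of the \<open>L\<^sup>q\<close>.\<close>
definition vertex_coeff :: "nat \<Rightarrow> nat \<Rightarrow> real" where
  "vertex_coeff n q =
    [[0, 0, 1/4, 0, -1],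
     [-1/4, 1/4, -1/4, 1/4, 1/4],
     [1/3, 0, 0, 0, 0],
     [1/6, 0, 0, -1/2, 3/2],
     [1/2, 0, 0, -1/2, 1/2]] ! (n - 1) ! (q - 1)"

definition vertex_tensor :: "nat \<Rightarrow> vec3 \<Rightarrow> tensor4" where
  "vertex_tensor n p = (\<chi> i j k l. \<Sum>q=1..5. vertex_coeff n q * L q p i j k l)"

lemma vertex_tensor_nth:
  "vertex_tensor n p $ i $ j $ k $ l = (\<Sum>q=1..5. vertex_coeff n q * L q p i j k l)"
  by (simp add: vertex_tensor_def)

lemma sum_1_5: "(\<Sum>q=1..5::nat. h q) = h 1 + h 2 + h 3 + h 4 + h 5"
  by (simp add: numeral_eq_Suc)

lemma in_1_5_cases:
  assumes "n \<in> {1..5::nat}"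
  obtains "n = 1" | "n = 2" | "n = 3" | "n = 4" | "n = 5"
  using assms by fastforce

context
  fixes \<rho> :: real and r :: vec3
  assumes nonneg: "\<rho> \<ge> 0"
begin

private definition j :: "nat \<Rightarrow> real" where "j n = spherical_bessel n (\<rho> * norm r)"

text \<open>Division by zero makes \<open>u\<close> vanish for \<open>r = 0\<close>, in accordance with the convention for \<open>L\<close>.\<close>
private definition u :: "3 \<Rightarrow> 3 \<Rightarrow> real" where "u a b = r $ a * r $ b / (norm r)\<^sup>2"

private lemma j_eq: "j n = (\<rho> * norm r)^n * bessel_series n ((norm (\<rho> *\<^sub>R r))\<^sup>2)"
  using nonneg by (simp add: j_def spherical_bessel_eq power_mult_distrib)

text \<open>Solving the recurrences for n = 0, 1, 2 leaves only j_0, j_2, j_4. b_3 is obtained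
  together with the factor s^2, s = \<rho> |r|, which avoids a division at s = 0; this suffices
  because b_3 always occurs with \<rho>^2 r_a r_b = s^2 u_ab.\<close>

private lemma bessel_series_1: "bessel_series 1 ((norm (\<rho> *\<^sub>R r))\<^sup>2) = (j 0 + j 2) / 3"
  and bessel_series_2:
  "bessel_series 2 ((norm (\<rho> *\<^sub>R r))\<^sup>2) = j 0 / 15 + 2 / 21 * j 2 + j 4 / 35"
  and bessel_series_3:
  "(\<rho> * norm r)\<^sup>2 * bessel_series 3 ((norm (\<rho> *\<^sub>R r))\<^sup>2) = (j 2 + j 4) / 7"
proof -
  define t where "t = (\<rho> * norm r)\<^sup>2"
  define b where "b = (\<lambda>n. bessel_series n ((norm (\<rho> *\<^sub>R r))\<^sup>2))"
  have t: "(norm (\<rho> *\<^sub>R r))\<^sup>2 = t"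
    by (simp add: t_def power_mult_distrib)
  have j: "j 0 = b 0" "j 2 = t * b 2" "j 4 = t * (t * b 4)"
    by (simp_all add: j_eq b_def t_def power4_eq_xxxx power2_eq_square)
  have b: "b 0 + t * b 2 = 3 * b 1" "b 1 + t * b 3 = 5 * b 2" "b 2 + t * b 4 = 7 * b 3"
    unfolding b_def t using bessel_series_recurrence[of 0 t] bessel_series_recurrence[of 1 t]
      bessel_series_recurrence[of 2 t] by (simp_all add: numeral_eq_Suc)
  have 3: "t * b 3 = (j 2 + j 4) / 7"
    unfolding j(2,3) using arg_cong[OF b(3), of "\<lambda>x. t * x"] by (simp add: algebra_simps)
  then show "(\<rho> * norm r)\<^sup>2 * bessel_series 3 ((norm (\<rho> *\<^sub>R r))\<^sup>2) = (j 2 + j 4) / 7"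
    by (simp add: t_def b_def)
  have 1: "b 1 = (j 0 + j 2) / 3"
    using b(1) j(1,2) by simp
  then show "bessel_series 1 ((norm (\<rho> *\<^sub>R r))\<^sup>2) = (j 0 + j 2) / 3"
    by (simp only: b_def)
  have "b 2 = j 0 / 15 + 2 / 21 * j 2 + j 4 / 35"
    using b(2) unfolding 1 3 by (simp add: field_simps)
  then show "bessel_series 2 ((norm (\<rho> *\<^sub>R r))\<^sup>2) = j 0 / 15 + 2 / 21 * j 2 + j 4 / 35"
    by (simp only: b_def)
qed

private lemma avg2:
  "has_sphere_avg (\<lambda>\<omega>. \<omega> $ a * \<omega> $ b) (\<rho> *\<^sub>R r) (of_real (kron a b * ((j 0 + j 2) / 3) - j 2 * u a b))"
proof (rule has_sphere_avg_cong[OF has_sphere_avg_moment2 refl])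
  \<comment> \<open>The factor |r|^2 contained in j_2 absorbs the denominator of \<open>u\<close>;
    at r = 0 both sides are zero.\<close>
  have "j 2 * u a b = \<rho>\<^sup>2 * (r $ a * r $ b) * bessel_series 2 ((norm (\<rho> *\<^sub>R r))\<^sup>2)"
    unfolding j_eq u_def by (cases "r = 0") (simp_all add: power_mult_distrib)
  then show "complex_of_real (kron a b * ((j 0 + j 2) / 3) - j 2 * u a b) =
      of_real (kron a b * bessel_series 1 ((norm (\<rho> *\<^sub>R r))\<^sup>2)
        - (\<rho> *\<^sub>R r) $ a * (\<rho> *\<^sub>R r) $ b * bessel_series 2 ((norm (\<rho> *\<^sub>R r))\<^sup>2))"
    unfolding bessel_series_1 of_real_eq_iff by (simp add: power2_eq_square)
qed

private lemma avg4:
  "has_sphere_avg (\<lambda>\<omega>. \<omega> $ a * \<omega> $ b * \<omega> $ c * \<omega> $ d) (\<rho> *\<^sub>R r) (of_real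
     ((kron a b * kron c d + kron a c * kron b d + kron a d * kron b c) * (j 0 / 15 + 2 / 21 * j 2 + j 4 / 35)
      - (kron a b * u c d + kron a c * u b d + kron a d * u b c + kron b c * u a d + kron b d * u a c
          + kron c d * u a b) * ((j 2 + j 4) / 7)
      + u a b * u c d * j 4))"
proof (rule has_sphere_avg_cong[OF has_sphere_avg_moment4 refl])
  define b3 where "b3 = bessel_series 3 ((norm (\<rho> *\<^sub>R r))\<^sup>2)"
  have 3: "u x y * ((j 2 + j 4) / 7) = \<rho>\<^sup>2 * (r $ x * r $ y) * b3" for x y
    unfolding bessel_series_3[symmetric] b3_def[symmetric] u_def
    by (cases "r = 0") (simp_all add: power_mult_distrib)
  have 4: "u a b * u c d * j 4 = \<rho> ^ 4 * (r $ a * r $ b * r $ c * r $ d) * bessel_series 4 ((norm (\<rho> *\<^sub>R r))\<^sup>2)"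
    unfolding j_eq u_def power_mult_distrib power4_eq_xxxx power2_eq_square
    by (cases "r = 0") simp_all
  have "(kron a b * u c d + kron a c * u b d + kron a d * u b c + kron b c * u a d + kron b d * u a c
          + kron c d * u a b) * ((j 2 + j 4) / 7) =
      kron a b * (u c d * ((j 2 + j 4) / 7)) + kron a c * (u b d * ((j 2 + j 4) / 7))
      + kron a d * (u b c * ((j 2 + j 4) / 7)) + kron b c * (u a d * ((j 2 + j 4) / 7))
      + kron b d * (u a c * ((j 2 + j 4) / 7)) + kron c d * (u a b * ((j 2 + j 4) / 7))"
    by (simp only: distrib_right mult.assoc)
  also have "\<dots> = (kron a b * ((\<rho> *\<^sub>R r) $ c * (\<rho> *\<^sub>R r) $ d) + kron a c * ((\<rho> *\<^sub>R r) $ b * (\<rho> *\<^sub>R r) $ d)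
         + kron a d * ((\<rho> *\<^sub>R r) $ b * (\<rho> *\<^sub>R r) $ c) + kron b c * ((\<rho> *\<^sub>R r) $ a * (\<rho> *\<^sub>R r) $ d)
         + kron b d * ((\<rho> *\<^sub>R r) $ a * (\<rho> *\<^sub>R r) $ c) + kron c d * ((\<rho> *\<^sub>R r) $ a * (\<rho> *\<^sub>R r) $ b)) * b3"
    unfolding 3 by (simp add: power2_eq_square algebra_simps)
  finally show "complex_of_real ((kron a b * kron c d + kron a c * kron b d + kron a d * kron b c)
        * (j 0 / 15 + 2 / 21 * j 2 + j 4 / 35)
      - (kron a b * u c d + kron a c * u b d + kron a d * u b c + kron b c * u a d + kron b d * u a c
          + kron c d * u a b) * ((j 2 + j 4) / 7)
      + u a b * u c d * j 4) = of_real
     ((kron a b * kron c d + kron a c * kron b d + kron a d * kron b c) * bessel_series 2 ((norm (\<rho> *\<^sub>R r))\<^sup>2)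
      - (kron a b * ((\<rho> *\<^sub>R r) $ c * (\<rho> *\<^sub>R r) $ d) + kron a c * ((\<rho> *\<^sub>R r) $ b * (\<rho> *\<^sub>R r) $ d)
         + kron a d * ((\<rho> *\<^sub>R r) $ b * (\<rho> *\<^sub>R r) $ c) + kron b c * ((\<rho> *\<^sub>R r) $ a * (\<rho> *\<^sub>R r) $ d)
         + kron b d * ((\<rho> *\<^sub>R r) $ a * (\<rho> *\<^sub>R r) $ c) + kron c d * ((\<rho> *\<^sub>R r) $ a * (\<rho> *\<^sub>R r) $ b))
          * bessel_series 3 ((norm (\<rho> *\<^sub>R r))\<^sup>2)
      + (\<rho> *\<^sub>R r) $ a * (\<rho> *\<^sub>R r) $ b * (\<rho> *\<^sub>R r) $ c * (\<rho> *\<^sub>R r) $ d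
          * bessel_series 4 ((norm (\<rho> *\<^sub>R r))\<^sup>2))"
    unfolding bessel_series_2 b3_def[symmetric] 4 of_real_eq_iff
    by (simp add: power4_eq_xxxx)
qed

private lemma L_unit: "norm \<omega> = 1 \<Longrightarrow> L q \<omega> a b c d =
    [kron a b * kron c d,
     kron a c * kron b d + kron a d * kron b c,
     kron a d * (\<omega> $ b * \<omega> $ c) + kron b c * (\<omega> $ a * \<omega> $ d) +
      kron b d * (\<omega> $ a * \<omega> $ c) + kron a c * (\<omega> $ b * \<omega> $ d),
     kron c d * (\<omega> $ a * \<omega> $ b) + kron a b * (\<omega> $ c * \<omega> $ d),
     \<omega> $ a * \<omega> $ b * \<omega> $ c * \<omega> $ d] ! (q - 1)"
  by (simp add: L_def)

private lemma L_u: "L q r a b c d =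
    [kron a b * kron c d,
     kron a c * kron b d + kron a d * kron b c,
     kron a d * u b c + kron b c * u a d + kron b d * u a c + kron a c * u b d,
     kron c d * u a b + kron a b * u c d,
     u a b * u c d] ! (q - 1)"
  by (simp add: L_def u_def add_divide_distrib power4_eq_xxxx power2_eq_square mult.assoc)

text \<open>Averaging maps the span of the L^q to itself: entry q is the mean of \<open>L q\<close>,
  expressed through the same tensors at r. The factors 2 arise because each product of deltas occurs
  twice once the second moments are inserted.\<close>

private definition A :: "3 \<Rightarrow> 3 \<Rightarrow> 3 \<Rightarrow> 3 \<Rightarrow> nat \<Rightarrow> real" where
  "A a b c d q =
    [L 1 r a b c d * j 0,
     L 2 r a b c d * j 0,
     2 * L 2 r a b c d * ((j 0 + j 2) / 3) - L 3 r a b c d * j 2,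
     2 * L 1 r a b c d * ((j 0 + j 2) / 3) - L 4 r a b c d * j 2,
     (L 1 r a b c d + L 2 r a b c d) * (j 0 / 15 + 2 / 21 * j 2 + j 4 / 35)
       - (L 3 r a b c d + L 4 r a b c d) * ((j 2 + j 4) / 7) + L 5 r a b c d * j 4] ! (q - 1)"

private lemma avg_L:
  assumes "q \<in> {1..5}"
  shows "has_sphere_avg (\<lambda>\<omega>. L q \<omega> a b c d) (\<rho> *\<^sub>R r) (of_real (A a b c d q))"
proof -
  have avg0: "has_sphere_avg (\<lambda>\<omega>. x) (\<rho> *\<^sub>R r) (of_real (x * j 0))" for x
    using has_sphere_avg_cmul[OF has_sphere_avg_1[of "\<rho> *\<^sub>R r"], of x] by (simp add: j_eq)
  note avg2' = has_sphere_avg_cmul[OF avg2]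
  from assms show ?thesis
  proof (cases rule: in_1_5_cases)
    case 1
    show ?thesis
      by (rule has_sphere_avg_cong[OF avg0[of "L 1 r a b c d"]]) (simp_all add: 1 L_unit L_u A_def)
  next
    case 2
    show ?thesis
      by (rule has_sphere_avg_cong[OF avg0[of "L 2 r a b c d"]]) (simp_all add: 2 L_unit L_u A_def)
  next
    case 3
    show ?thesis
      by (rule has_sphere_avg_cong[OF has_sphere_avg_add[OF has_sphere_avg_add[OF has_sphere_avg_add[OF
              avg2'[of "kron a d" b c] avg2'[of "kron b c" a d]]
              avg2'[of "kron b d" a c]] avg2'[of "kron a c" b d]]])
         (simp_all only: 3 L_unit of_real_mult[symmetric] of_real_add[symmetric] of_real_eq_iff,
          simp_all add: L_u A_def algebra_simps add_divide_distrib)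
  next
    case 4
    show ?thesis
      by (rule has_sphere_avg_cong[OF has_sphere_avg_add[OF avg2'[of "kron c d" a b] avg2'[of "kron a b" c d]]])
         (simp_all only: 4 L_unit of_real_mult[symmetric] of_real_add[symmetric] of_real_eq_iff,
          simp_all add: L_u A_def algebra_simps add_divide_distrib)
  next
    case 5
    show ?thesis
      by (rule has_sphere_avg_cong[OF avg4[of a b c d]])
         (simp_all only: 5 L_unit of_real_eq_iff, simp_all add: L_u A_def algebra_simps add_divide_distrib)
  qed
qed

text \<open>The origin of the table: \<open>N_tilde\<close> is the matrix product of
  \<open>vertex_coeff\<close> with the averages \<open>A\<close>, compared row by row in j_0, j_2,
  j_4.\<close>

lemma has_sphere_avg_vertex_tensor:
  assumes "n \<in> {1..5}"
  shows "has_sphere_avg (\<lambda>\<omega>. vertex_tensor n \<omega> $ a $ b $ c $ d) (\<rho> *\<^sub>R r)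
    (of_real (\<Sum>q=1..5. N_tilde n q \<rho> (norm r) * L q r a b c d))"
proof -
  have "has_sphere_avg (\<lambda>\<omega>. \<Sum>q=1..5. vertex_coeff n q * L q \<omega> a b c d) (\<rho> *\<^sub>R r)
      (\<Sum>q=1..5. of_real (vertex_coeff n q) * of_real (A a b c d q))"
    by (intro has_sphere_avg_sum has_sphere_avg_cmul avg_L) auto
  moreover have "(\<Sum>q=1..5. N_tilde n q \<rho> (norm r) * L q r a b c d) = (\<Sum>q=1..5. vertex_coeff n q * A a b c d q)"
    using assms
    by (cases rule: in_1_5_cases)
       (simp_all only: sum_1_5, simp_all add: N_tilde_def Let_def vertex_coeff_def A_def j_def[symmetric],
        simp_all add: algebra_simps add_divide_distrib diff_divide_distrib)
  ultimately show ?thesis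
    by (simp add: vertex_tensor_nth)
qed

end

section \<open>Equivariance of the vertex tensors\<close>

lemma UU_nth: "UU g F $ i $ j $ k $ l = (\<Sum>a\<in>UNIV. \<Sum>b\<in>UNIV. \<Sum>c\<in>UNIV. \<Sum>d\<in>UNIV.
     g $ i $ a * g $ j $ b * g $ k $ c * g $ l $ d * F $ a $ b $ c $ d)"
  by (simp add: UU_def)

lemma UU_add: "UU g (F + G) = UU g F + UU g G"
  by (simp add: vec_eq_iff UU_nth distrib_left sum.distrib)

lemma UU_scaleR: "UU g (c *\<^sub>R F) = c *\<^sub>R UU g F"
  by (simp add: vec_eq_iff UU_nth sum_distrib_left mult_ac)

lemma UU_sum: "finite A \<Longrightarrow> UU g (\<Sum>x\<in>A. F x) = (\<Sum>x\<in>A. UU g (F x))"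
  by (induction A rule: finite_induct) (simp_all add: UU_add, simp add: vec_eq_iff UU_nth)

text \<open>Permuting tensor slots commutes with the group action. With \<open>swap_right\<close>
  and products of rank 2 tensors this builds every \<open>L\<close>, so equivariance is inherited
  from the identity and from \<open>outer\<close>. Applied to the product of two identities it later
  represents the trace.\<close>

definition swap_middle :: "tensor4 \<Rightarrow> tensor4" where
  "swap_middle F = (\<chi> i j k l. F $ i $ k $ j $ l)"

definition swap_right :: "tensor4 \<Rightarrow> tensor4" where
  "swap_right F = (\<chi> i j k l. F $ i $ j $ l $ k)"

lemma UU_swap_middle: "UU g (swap_middle F) = swap_middle (UU g F)"
proof -
  have "(\<Sum>b\<in>UNIV. \<Sum>c\<in>UNIV. \<Sum>d\<in>UNIV. g $ i $ a * g $ j $ b * g $ k $ c * g $ l $ d * F $ a $ c $ b $ d) =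
      (\<Sum>b\<in>UNIV. \<Sum>c\<in>UNIV. \<Sum>d\<in>UNIV. g $ i $ a * g $ k $ b * g $ j $ c * g $ l $ d * F $ a $ b $ c $ d)"
    for i j k l a
    by (subst sum.swap) (simp add: mult_ac)
  then show ?thesis
    by (simp add: vec_eq_iff UU_nth swap_middle_def)
qed

lemma UU_swap_right: "UU g (swap_right F) = swap_right (UU g F)"
proof -
  have "(\<Sum>c\<in>UNIV. \<Sum>d\<in>UNIV. g $ i $ a * g $ j $ b * g $ k $ c * g $ l $ d * F $ a $ b $ d $ c) =
      (\<Sum>c\<in>UNIV. \<Sum>d\<in>UNIV. g $ i $ a * g $ j $ b * g $ l $ c * g $ k $ d * F $ a $ b $ c $ d)"
    for i j k l a b
    by (subst sum.swap) (simp add: mult_ac)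
  then show ?thesis
    by (simp add: vec_eq_iff UU_nth swap_right_def)
qed

lemma U_id: "orthogonal_matrix g \<Longrightarrow> U g (mat 1) = mat 1"
  by (simp add: U_def orthogonal_matrix_def)

text \<open>The orthogonal projection onto the line through a nonzero p; it is zero at p = 0, in
  accordance with the convention for \<open>L\<close>.\<close>

definition outer :: "vec3 \<Rightarrow> tensor2" where
  "outer p = (\<chi> i j. p $ i * p $ j / (norm p)\<^sup>2)"

lemma norm_orthogonal_matrix: "orthogonal_matrix g \<Longrightarrow> norm (g *v p) = norm (p::vec3)"
  using orthogonal_transformation_matrix[of "(*v) g"]
  by (simp add: orthogonal_transformation_norm)

lemma U_outer:
  assumes "orthogonal_matrix g"
  shows "U g (outer p) = outer (g *v p)"
proof -
  have "U g (outer p) $ i $ j = outer (g *v p) $ i $ j" for i j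
    unfolding outer_def norm_orthogonal_matrix[OF assms]
    by (simp add: U_def matrix_matrix_mult_def transpose_def matrix_vector_mult_def sum_index
        add_divide_distrib algebra_simps)
  then show ?thesis
    by (simp add: vec_eq_iff)
qed

definition L_tensor :: "nat \<Rightarrow> vec3 \<Rightarrow> tensor4" where
  "L_tensor q p = (\<chi> i j k l. L q p i j k l)"

lemma L_tensor_eq:
  "L_tensor 1 p = tensor_prod (mat 1) (mat 1)"
  "L_tensor 2 p = swap_middle (tensor_prod (mat 1) (mat 1)) + swap_right (swap_middle (tensor_prod (mat 1) (mat 1)))"
  "L_tensor 3 p = swap_middle (L_tensor 4 p) + swap_right (swap_middle (L_tensor 4 p))"
  "L_tensor 4 p = tensor_prod (mat 1) (outer p) + tensor_prod (outer p) (mat 1)"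
  "L_tensor 5 p = tensor_prod (outer p) (outer p)"
  by (auto simp: vec_eq_iff L_tensor_def L_def tensor_prod_def mat_def kron_def swap_middle_def
      swap_right_def outer_def power4_eq_xxxx power2_eq_square add_divide_distrib)

lemma UU_L_tensor:
  assumes "orthogonal_matrix g" "q \<in> {1..5}"
  shows "UU g (L_tensor q p) = L_tensor q (g *v p)"
  using assms(2)
  by (cases rule: in_1_5_cases)
     (simp_all only: L_tensor_eq UU_add UU_swap_middle UU_swap_right UU_tensor_prod U_id[OF assms(1)]
        U_outer[OF assms(1)])

lemma vertex_tensor_eq: "vertex_tensor n p = (\<Sum>q=1..5. vertex_coeff n q *\<^sub>R L_tensor q p)"
  by (simp add: vec_eq_iff vertex_tensor_nth L_tensor_def)

lemma UU_vertex_tensor: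
  assumes "orthogonal_matrix g"
  shows "UU g (vertex_tensor n p) = vertex_tensor n (g *v p)"
  using assms by (simp add: vertex_tensor_eq UU_sum UU_scaleR UU_L_tensor)

lemma vertex_tensor_scaleR:
  assumes "c \<noteq> 0" "n \<in> {1..5}"
  shows "vertex_tensor n (c *\<^sub>R p) = vertex_tensor n p"
proof -
  have outer: "outer (c *\<^sub>R p) = outer p"
    using assms by (simp add: outer_def power_mult_distrib vec_eq_iff power2_eq_square[of c])
  have "L_tensor q (c *\<^sub>R p) = L_tensor q p" if "q \<in> {1..5}" for q
    using that by (cases rule: in_1_5_cases) (simp_all only: L_tensor_eq outer)
  then show ?thesis
    by (simp add: vertex_tensor_eq)
qed

section \<open>Matrices of size six and the values at the pole\<close>

lemma exhaust_6: "x = 1 \<or> x = 2 \<or> x = 3 \<or> x = 4 \<or> x = 5 \<or> x = 6" for x :: 6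
proof (induct x)
  case (of_int z)
  then have "z = 0 \<or> z = 1 \<or> z = 2 \<or> z = 3 \<or> z = 4 \<or> z = 5" by fastforce
  then show ?case by auto
qed

lemma forall_6: "(\<forall>i::6. P i) \<longleftrightarrow> P 1 \<and> P 2 \<and> P 3 \<and> P 4 \<and> P 5 \<and> P 6"
  by (metis exhaust_6)

lemma UNIV_6: "UNIV = {1, 2, 3, 4, 5, 6::6}"
  using exhaust_6 by auto

lemma sum_6: "sum f (UNIV::6 set) = f 1 + f 2 + f 3 + f 4 + f 5 + f 6"
  unfolding UNIV_6 by (simp add: ac_simps)

lemma vector_6:
  "(vector [a,b,c,d,e,f] :: ('a::zero)^6) $ 1 = a"
  "(vector [a,b,c,d,e,f] :: ('a::zero)^6) $ 2 = b"
  "(vector [a,b,c,d,e,f] :: ('a::zero)^6) $ 3 = c"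
  "(vector [a,b,c,d,e,f] :: ('a::zero)^6) $ 4 = d"
  "(vector [a,b,c,d,e,f] :: ('a::zero)^6) $ 5 = e"
  "(vector [a,b,c,d,e,f] :: ('a::zero)^6) $ 6 = f"
  unfolding vector_def by simp_all

definition vertex_matrix :: "nat \<Rightarrow> real^6^6" where
  "vertex_matrix n = [D1, D2, D3, D4, D5] ! (n - 1)"

abbreviation pole :: vec3 where "pole \<equiv> spherical 1 0 0"

lemma pole_nth: "pole $ (-1) = 0" "pole $ 0 = 1" "pole $ 1 = 0"
  by (simp_all add: spherical_def)

lemma norm_pole: "norm pole = 1"
  by (simp add: norm_spherical)

lemma tau_nth: "tau F $ m $ n = (if fst (index_pair m) = snd (index_pair m) then 1 else sqrt 2) *
   (if fst (index_pair n) = snd (index_pair n) then 1 else sqrt 2) *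
   F $ fst (index_pair m) $ snd (index_pair m) $ fst (index_pair n) $ snd (index_pair n)"
  by (simp add: tau_def split_beta)

lemma index_pair_simps:
  "index_pair 1 = (-1, -1)" "index_pair 2 = (0, 0)" "index_pair 3 = (1, 1)"
  "index_pair 4 = (-1, 0)" "index_pair 5 = (1, -1)" "index_pair 6 = (0, 1)"
  by (simp_all add: index_pair_def)

lemma vertex_tensor_nth_expand:
  "vertex_tensor n p $ i $ j $ k $ l = vertex_coeff n 1 * L 1 p i j k l + vertex_coeff n 2 * L 2 p i j k l
     + vertex_coeff n 3 * L 3 p i j k l + vertex_coeff n 4 * L 4 p i j k l + vertex_coeff n 5 * L 5 p i j k l"
  by (simp only: vertex_tensor_nth sum_1_5)

text \<open>This is what pins down the rows of \<open>vertex_coeff\<close>: at the unit vector along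
  the axis with index 0 every product of coordinates is 0 or 1, so the matrices can be compared
  entry by entry.\<close>

lemma tau_vertex_tensor_pole:
  assumes "n \<in> {1..5}"
  shows "tau (vertex_tensor n pole) = vertex_matrix n"
  using assms
  by (cases rule: in_1_5_cases)
     (simp_all add: vec_eq_iff forall_6 tau_nth index_pair_simps vertex_matrix_def
       D1_def D2_def D3_def D4_def D5_def vector_6 vertex_tensor_nth_expand vertex_coeff_def
       L_def kron_def pole_nth norm_pole)

section \<open>The simplex\<close>

definition tensor4_symmetric :: "tensor4 \<Rightarrow> bool" where
  "tensor4_symmetric F \<longleftrightarrow> (\<forall>i j k l. F $ i $ j $ k $ l = F $ j $ i $ k $ l \<and>
       F $ i $ j $ k $ l = F $ i $ j $ l $ k \<and> F $ i $ j $ k $ l = F $ k $ l $ i $ j)"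

lemma kron_commute: "kron i j = kron j i"
  by (simp add: kron_def)

lemma tensor4_symmetric_vertex_tensor: "n \<in> {1..5} \<Longrightarrow> tensor4_symmetric (vertex_tensor n p)"
  unfolding tensor4_symmetric_def vertex_tensor_nth_expand
  by (intro allI conjI arg_cong2[where f = "(+)"] arg_cong2[where f = "(*)"] refl)
     (simp_all add: L_def kron_commute mult_ac add_ac)

lemma tensor4_symmetric_sum:
  "(\<And>x. x \<in> A \<Longrightarrow> tensor4_symmetric (F x)) \<Longrightarrow> tensor4_symmetric (\<Sum>x\<in>A. c x *\<^sub>R F x)"
  unfolding tensor4_symmetric_def by (auto intro!: sum.cong)

text \<open>Up to the symmetries every component occurs in the matrix, scaled by a nonzero
  factor.\<close>

lemma tau_inject:
  assumes F: "tensor4_symmetric F" and G: "tensor4_symmetric G" and eq: "tau F = tau G"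
  shows "F = G"
proof -
  have surj: "\<exists>m. index_pair m = (i, j) \<or> index_pair m = (j, i)" for i j
  proof -
    have "\<forall>i j. \<exists>m\<in>{1, 2, 3, 4, 5, 6}. index_pair m = (i, j) \<or> index_pair m = (j, i)"
      by (simp add: forall_index index_pair_simps)
    then show ?thesis by blast
  qed
  have "F $ i $ j $ k $ l = G $ i $ j $ k $ l" for i j k l
  proof -
    obtain m n where mn: "index_pair m = (i, j) \<or> index_pair m = (j, i)"
      "index_pair n = (k, l) \<or> index_pair n = (l, k)"
      using surj by metis
    have "tau F $ m $ n = tau G $ m $ n"
      by (simp add: eq)
    then have "F $ fst (index_pair m) $ snd (index_pair m) $ fst (index_pair n) $ snd (index_pair n) =
        G $ fst (index_pair m) $ snd (index_pair m) $ fst (index_pair n) $ snd (index_pair n)"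
      by (simp add: tau_nth split: if_splits)
    then show ?thesis
      using F G mn unfolding tensor4_symmetric_def by (metis fst_conv snd_conv)
  qed
  then show ?thesis
    by (simp add: vec_eq_iff)
qed

lemma tau_sum: "tau (\<Sum>x\<in>A. c x *\<^sub>R F x) = (\<Sum>x\<in>A. c x *\<^sub>R tau (F x))"
  by (simp add: vec_eq_iff tau_nth sum_distrib_left mult_ac)

text \<open>Barycentric coordinates with respect to the vertices \<open>D1, \<dots>, D5\<close>.\<close>
definition simplex_coord :: "nat \<Rightarrow> real^6^6 \<Rightarrow> real" where
  "simplex_coord n X =
    [2 * X $ 4 $ 4, 2 * X $ 5 $ 5, X $ 2 $ 2 + 2 * X $ 1 $ 2, X $ 2 $ 2 - X $ 1 $ 2,
     2 * X $ 1 $ 3 + X $ 5 $ 5 - X $ 2 $ 2 - X $ 1 $ 2] ! (n - 1)"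

text \<open>The hull only asserts that weights exist; computing them by linear functionals makes
  them measurable in \<rho> later. The functionals are defined on all matrices, so the last equation
  confines X to the span of the vertices.\<close>

definition has_simplex_coords :: "real^6^6 \<Rightarrow> bool" where
  "has_simplex_coords X \<longleftrightarrow> (\<forall>n\<in>{1..5}. 0 \<le> simplex_coord n X) \<and>
     (\<Sum>n=1..5. simplex_coord n X) = 1 \<and> X = (\<Sum>n=1..5. simplex_coord n X *\<^sub>R vertex_matrix n)"

lemma simplex_coord_linear:
  assumes "n \<in> {1..5}"
  shows "simplex_coord n (a *\<^sub>R X + b *\<^sub>R Y) = a * simplex_coord n X + b * simplex_coord n Y"
  using assms by (cases rule: in_1_5_cases) (simp_all add: simplex_coord_def algebra_simps)

lemma convex_simplex_coords: "convex {X. has_simplex_coords X}"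
proof (rule convexI)
  fix X Y :: "real^6^6" and a b :: real
  assume *: "X \<in> {X. has_simplex_coords X}" "Y \<in> {X. has_simplex_coords X}"
    and ab: "0 \<le> a" "0 \<le> b" "a + b = 1"
  then have X: "has_simplex_coords X" and Y: "has_simplex_coords Y" by auto
  have "(\<Sum>n=1..5. simplex_coord n (a *\<^sub>R X + b *\<^sub>R Y) *\<^sub>R vertex_matrix n) =
      a *\<^sub>R (\<Sum>n=1..5. simplex_coord n X *\<^sub>R vertex_matrix n) + b *\<^sub>R (\<Sum>n=1..5. simplex_coord n Y *\<^sub>R vertex_matrix n)"
    by (simp add: simplex_coord_linear scaleR_add_left sum.distrib scaleR_sum_right)
  moreover have "(\<Sum>n=1..5. simplex_coord n (a *\<^sub>R X + b *\<^sub>R Y)) =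
      a * (\<Sum>n=1..5. simplex_coord n X) + b * (\<Sum>n=1..5. simplex_coord n Y)"
    by (simp add: simplex_coord_linear sum.distrib sum_distrib_left)
  ultimately show "a *\<^sub>R X + b *\<^sub>R Y \<in> {X. has_simplex_coords X}"
    using X Y ab by (simp add: has_simplex_coords_def simplex_coord_linear)
qed

text \<open>The functionals are dual to the vertices; the terms of the fifth other than the entry
  (1,3) remove what \<open>D2\<close>, \<open>D3\<close> and \<open>D4\<close> contribute to that
  entry.\<close>

lemma simplex_coord_vertex_matrix:
  assumes "m \<in> {1..5}" "n \<in> {1..5}"
  shows "simplex_coord m (vertex_matrix n) = (if m = n then 1 else 0)"
  using assms(2,1)
  by (elim in_1_5_cases)
     (simp_all add: simplex_coord_def vertex_matrix_def D1_def D2_def D3_def D4_def D5_def vector_6)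

lemma has_simplex_coords_vertex:
  assumes "n \<in> {1..5}"
  shows "has_simplex_coords (vertex_matrix n)"
  using assms unfolding has_simplex_coords_def
  by (simp add: simplex_coord_vertex_matrix if_distrib[of "\<lambda>c. c *\<^sub>R _"] sum.delta cong: if_cong del: One_nat_def)

lemma simplex_iff: "X \<in> convex hull {D1, D2, D3, D4, D5} \<longleftrightarrow> has_simplex_coords X"
proof
  have vertices: "{D1, D2, D3, D4, D5} = vertex_matrix ` {1..5}"
  proof -
    have "{1..5} = {1, 2, 3, 4, 5::nat}" by auto
    then show ?thesis by (simp add: vertex_matrix_def)
  qed
  show "has_simplex_coords X" if "X \<in> convex hull {D1, D2, D3, D4, D5}"
  proof -
    have "convex hull {D1, D2, D3, D4, D5} \<subseteq> {X. has_simplex_coords X}"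
      unfolding vertices using has_simplex_coords_vertex convex_simplex_coords
      by (intro hull_minimal) auto
    with that show ?thesis by blast
  qed
  show "X \<in> convex hull {D1, D2, D3, D4, D5}" if X: "has_simplex_coords X"
  proof -
    have "(\<Sum>n=1..5. simplex_coord n X *\<^sub>R vertex_matrix n) \<in> convex hull (vertex_matrix ` {1..5})"
      using X unfolding has_simplex_coords_def
      by (intro convex_sum) (auto intro: hull_inc)
    then show ?thesis
      using X unfolding has_simplex_coords_def vertices by simp
  qed
qed

lemma simplex_coord_combination:
  assumes "m \<in> {1..5}"
  shows "simplex_coord m (\<Sum>n=1..5. u n *\<^sub>R vertex_matrix n) = u m"
proof -
  have "linear (simplex_coord m)"
    using simplex_coord_linear[OF assms, of 1 _ 1] simplex_coord_linear[OF assms, of _ _ 0]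
    by (intro linearI) simp_all
  then have "simplex_coord m (\<Sum>n=1..5. u n *\<^sub>R vertex_matrix n) =
      (\<Sum>n=1..5. u n * simplex_coord m (vertex_matrix n))"
    by (simp add: linear_sum linear_scale)
  also have "\<dots> = u m"
    using assms by (simp add: simplex_coord_vertex_matrix if_distrib[of "\<lambda>c. _ * c"] sum.delta cong: if_cong del: One_nat_def)
  finally show ?thesis .
qed

lemma simplexI:
  assumes "\<And>n. n \<in> {1..5} \<Longrightarrow> 0 \<le> u n" "(\<Sum>n=1..5. u n) = 1"
  shows "(\<Sum>n=1..5. u n *\<^sub>R vertex_matrix n) \<in> convex hull {D1, D2, D3, D4, D5}"
  unfolding simplex_iff has_simplex_coords_def using assms
  by (simp add: simplex_coord_combination del: One_nat_def)

section \<open>Positivity and trace as inner products\<close>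

lemma inner_tensor_op: "e \<bullet> tensor_op F e = F \<bullet> tensor_prod e e"
  by (simp add: inner_vec_def tensor_op_def tensor_prod_def sum_distrib_left mult_ac)

lemma inner_tensor4: "(F::tensor4) \<bullet> G = (\<Sum>(i, j, k, l)\<in>UNIV. F $ i $ j $ k $ l * G $ i $ j $ k $ l)"
  by (simp add: inner_vec_def sum.cartesian_product split_beta flip: UNIV_Times_UNIV)

lemma UU_nth_tuple: "UU g F $ i $ j $ k $ l = (\<Sum>(a, b, c, d)\<in>UNIV.
     g $ i $ a * g $ j $ b * g $ k $ c * g $ l $ d * F $ a $ b $ c $ d)"
  by (simp add: UU_nth sum.cartesian_product split_beta flip: UNIV_Times_UNIV)

text \<open>Moves the action onto the test tensors, so that positivity and trace transfer from the
  pole to its orthogonal images.\<close>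

lemma UU_adjoint: "UU g F \<bullet> G = F \<bullet> UU (transpose g) G"
  unfolding inner_tensor4 UU_nth_tuple split_beta sum_distrib_left sum_distrib_right
  by (subst sum.swap) (simp add: transpose_def mult_ac)

text \<open>The two factors \<open>sqrt 2\<close> give each off-diagonal pair weight 2, once for
  each order of its indices. The trace is thus the full contraction F_ijij, which O(3) leaves
  invariant.\<close>

lemma trace_tau:
  assumes "tensor4_symmetric F"
  shows "trace (tau F) = F \<bullet> swap_middle (tensor_prod (mat 1) (mat 1))"
proof -
  have s: "F $ 0 $ (-1) $ 0 $ (-1) = F $ (-1) $ 0 $ (-1) $ 0" "F $ 1 $ 0 $ 1 $ 0 = F $ 0 $ 1 $ 0 $ 1"
     "F $ (-1) $ 1 $ (-1) $ 1 = F $ 1 $ (-1) $ 1 $ (-1)"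
    using assms unfolding tensor4_symmetric_def by metis+
  show ?thesis
    by (simp add: trace_def sum_6 tau_nth index_pair_simps inner_vec_def sum_index swap_middle_def
        tensor_prod_def mat_def s)
qed

lemma unit_trace_psd_iff:
  "F \<in> unit_trace_psd \<longleftrightarrow> tensor4_symmetric F \<and> (\<forall>e\<in>S2. 0 \<le> F \<bullet> tensor_prod e e) \<and>
     F \<bullet> swap_middle (tensor_prod (mat 1) (mat 1)) = 1"
  using trace_tau[of F] by (auto simp: unit_trace_psd_def inner_tensor_op tensor4_symmetric_def)

lemma ex_orthogonal_pole:
  assumes "norm p = 1"
  obtains g where "orthogonal_matrix g" "g *v pole = p"
proof -
  obtain f where f: "orthogonal_transformation f" "f pole = p"
    by (rule orthogonal_transformation_exists[of pole p]) (use assms norm_pole in auto)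
  then have "orthogonal_matrix (matrix f)" "matrix f *v pole = p"
    using orthogonal_transformation_matrix[of f] by (simp_all add: matrix_works)
  then show ?thesis by (rule that)
qed

lemma vertex_tensor_pole_psd:
  assumes "n \<in> {1..5}"
  shows "vertex_tensor n pole \<in> unit_trace_psd"
proof -
  have "0 \<le> e \<bullet> tensor_op (vertex_tensor n pole) e" if "e \<in> S2" for e
  proof -
    have "e $ i $ j = e $ j $ i" for i j
      using that by (simp add: S2_def transpose_def vec_eq_iff)
    then have s: "e $ 0 $ (-1) = e $ (-1) $ 0" "e $ 1 $ 0 = e $ 0 $ 1" "e $ (-1) $ 1 = e $ 1 $ (-1)"
      by blast+
    let ?a = "e $ (-1) $ (-1)" and ?b = "e $ 0 $ 0" and ?c = "e $ 1 $ 1"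
    \<comment> \<open>\<open>D1\<close> and \<open>D2\<close> are half the projections onto planes
      of the six-dimensional space, \<open>D3\<close>, \<open>D4\<close> and \<open>D5\<close> are
      projections onto lines; hence one or two squares in each form.\<close>
    have "e \<bullet> tensor_op (vertex_tensor n pole) e =
        [(e $ (-1) $ 0)\<^sup>2 + (e $ 0 $ 1)\<^sup>2, (?a - ?c)\<^sup>2 / 4 + (e $ 1 $ (-1))\<^sup>2, (?a + ?b + ?c)\<^sup>2 / 3,
         (?a - 2 * ?b + ?c)\<^sup>2 / 6, (?a + ?c)\<^sup>2 / 2] ! (n - 1)"
      using assms
      by (cases rule: in_1_5_cases)
         (simp_all add: inner_vec_def tensor_op_def sum_index vertex_tensor_nth_expand vertex_coeff_def
            L_def kron_def pole_nth norm_pole s, simp_all add: power2_eq_square field_simps)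
    also have "\<dots> \<ge> 0"
      using assms by (cases rule: in_1_5_cases) simp_all
    finally show ?thesis .
  qed
  moreover have "trace (tau (vertex_tensor n pole)) = 1"
    unfolding tau_vertex_tensor_pole[OF assms] using assms
    by (cases rule: in_1_5_cases)
       (simp_all add: trace_def sum_6 vertex_matrix_def D1_def D2_def D3_def D4_def D5_def vector_6)
  ultimately show ?thesis
    using tensor4_symmetric_vertex_tensor[OF assms, of pole]
    by (simp add: unit_trace_psd_def tensor4_symmetric_def)
qed

text \<open>A nonzero p is a positive multiple of an orthogonal image of the pole. The origin is
  excluded since L^3, L^4, L^5 vanish there: \<open>vertex_tensor 1 0\<close>, for instance, is
  zero.\<close>

lemma vertex_tensor_psd:
  assumes "n \<in> {1..5}" "p \<noteq> 0"
  shows "vertex_tensor n p \<in> unit_trace_psd"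
proof -
  obtain g where g: "orthogonal_matrix g" "g *v pole = p /\<^sub>R norm p"
    using ex_orthogonal_pole[of "p /\<^sub>R norm p"] assms by auto
  have eq: "vertex_tensor n p = UU g (vertex_tensor n pole)"
    using assms vertex_tensor_scaleR[of "inverse (norm p)" n p] by (simp add: UU_vertex_tensor g)
  have g': "orthogonal_matrix (transpose g)"
    using g by simp
  have "0 \<le> vertex_tensor n p \<bullet> tensor_prod e e" if "e \<in> S2" for e
  proof -
    have "U (transpose g) e \<in> S2"
      using that by (simp add: S2_def U_def matrix_transpose_mul matrix_mul_assoc)
    then show ?thesis
      using vertex_tensor_pole_psd[OF assms(1)]
      unfolding eq UU_adjoint UU_tensor_prod unit_trace_psd_iff by blast
  qed
  moreover have "vertex_tensor n p \<bullet> swap_middle (tensor_prod (mat 1) (mat 1)) = 1"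
    using vertex_tensor_pole_psd[OF assms(1)]
    unfolding eq UU_adjoint UU_swap_middle UU_tensor_prod U_id[OF g'] unit_trace_psd_iff by blast
  ultimately show ?thesis
    using tensor4_symmetric_vertex_tensor[OF assms(1)] by (simp add: unit_trace_psd_iff)
qed

lemma unit_trace_psd_combination:
  assumes "\<And>n. n \<in> A \<Longrightarrow> F n \<in> unit_trace_psd" "\<And>n. n \<in> A \<Longrightarrow> 0 \<le> u n" "sum u A = 1"
  shows "(\<Sum>n\<in>A. u n *\<^sub>R F n) \<in> unit_trace_psd"
  using assms unfolding unit_trace_psd_iff
  by (auto simp: inner_sum_left intro!: tensor4_symmetric_sum sum_nonneg)

text \<open>Under these conditions the coefficients of \<open>L\<^sup>3, L\<^sup>4, L\<^sup>5\<close> cancel.\<close>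
lemma isotropic_combination:
  assumes "u 1 = u 2" "u 2 = 2 * u 4" "u 5 = 0"
  shows "(\<Sum>n=1..5. u n *\<^sub>R vertex_tensor n p) = (\<Sum>n=1..5. u n *\<^sub>R vertex_tensor n p')"
proof -
  have L: "L 1 p i j k l = kron i j * kron k l" "L 2 p i j k l = kron i k * kron j l + kron i l * kron j k"
    for p i j k l
    by (simp_all add: L_def)
  have "(\<Sum>n=1..5. u n *\<^sub>R vertex_tensor n p) $ i $ j $ k $ l =
     (u 3 / 3 - u 4 / 3) * L 1 p i j k l + u 4 / 2 * L 2 p i j k l"
    for p i j k l
    unfolding sum_1_5 using assms
    by (simp add: vertex_tensor_nth_expand vertex_coeff_def algebra_simps del: One_nat_def)
  then show ?thesis
    by (simp add: vec_eq_iff L del: One_nat_def)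
qed

section \<open>Spectral densities\<close>

lemma UU_signed_permutation:
  "UU (\<chi> i j. if j = \<pi> i then s i else 0) F $ i $ j $ k $ l =
     s i * s j * s k * s l * F $ \<pi> i $ \<pi> j $ \<pi> k $ \<pi> l"
  by (simp add: UU_nth if_distrib[of "\<lambda>x. x * _"] if_distrib[of "\<lambda>x. _ * x"] cong: if_cong)

lemma orthogonal_signed_permutation:
  fixes s :: "3 \<Rightarrow> real"
  assumes "inj \<pi>" "\<And>i. s i * s i = 1"
  shows "orthogonal_matrix (\<chi> i j. if j = \<pi> i then s i else 0)"
proof -
  have "(\<chi> i j. if j = \<pi> i then s i else 0) ** transpose (\<chi> i j. if j = \<pi> i then s i else 0) = (mat 1 :: real^3^3)"
    using assms by (auto simp: vec_eq_iff matrix_matrix_mult_def transpose_def mat_def inj_eq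
        if_distrib[of "\<lambda>x. x * _"] if_distrib[of "\<lambda>x. _ * x"] cong: if_cong)
  then show ?thesis
    by (simp add: orthogonal_matrix matrix_left_right_inverse)
qed

text \<open>Signed permutations reduce the tensor to three components, one further rotation links
  these, and positivity and trace then place the matrix in the simplex. This supplies the weights at
  \<rho> = 0.\<close>

lemma simplex_coords_isotropic:
  assumes F: "F \<in> unit_trace_psd" and inv: "\<And>g. orthogonal_matrix g \<Longrightarrow> UU g F = F"
  shows "has_simplex_coords (tau F)"
    and "simplex_coord 1 (tau F) = simplex_coord 2 (tau F)"
    and "simplex_coord 2 (tau F) = 2 * simplex_coord 4 (tau F)"
    and "simplex_coord 5 (tau F) = 0"
proof -
  have sym: "F $ i $ j $ k $ l = F $ j $ i $ k $ l" "F $ i $ j $ k $ l = F $ i $ j $ l $ k"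
      "F $ i $ j $ k $ l = F $ k $ l $ i $ j" for i j k l
    using F unfolding unit_trace_psd_def by blast+
  \<comment> \<open>Under the reflection of the coordinate \<open>a\<close>, a component in which
    \<open>a\<close> occurs an odd number of times equals its own negative.\<close>
  have flip: "F $ i $ j $ k $ l = 0" if "s i * s j * s k * s l = -1" "s = (\<lambda>i. if i = a then -1 else 1)"
    for s :: "3 \<Rightarrow> real" and a i j k l
  proof -
    have "orthogonal_matrix (\<chi> i j. if j = id i then s i else 0)"
      by (rule orthogonal_signed_permutation) (auto simp: that(2))
    then have "F $ i $ j $ k $ l = s i * s j * s k * s l * F $ i $ j $ k $ l"
      using inv[of "\<chi> i j. if j = id i then s i else 0"] UU_signed_permutation[of id s F i j k l] by simp
    with that(1) show ?thesis by simp
  qed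
  note flip = flip[OF _ refl, of _ 0] flip[OF _ refl, of _ 1] flip[OF _ refl, of _ "-1"]
  \<comment> \<open>The cyclic shift of the axes uses the arithmetic modulo 3 of the index
    type.\<close>
  have "orthogonal_matrix ((\<chi> i j. if j = i + 1 then 1 else 0) :: real^3^3)"
    using orthogonal_signed_permutation[of "\<lambda>i. i + 1" "\<lambda>_. 1"] by (simp add: inj_def)
  then have cyc: "F $ i $ j $ k $ l = F $ (i + 1) $ (j + 1) $ (k + 1) $ (l + 1)" for i j k l
    using inv[of "\<chi> i j. if j = i + 1 then 1 else 0"]
      UU_signed_permutation[of "\<lambda>i. i + 1" "\<lambda>_. 1" F i j k l] by simp
  define x y z where "x = F $ 0 $ 0 $ 0 $ 0" and "y = F $ 0 $ 0 $ 1 $ 1" and "z = F $ 0 $ 1 $ 0 $ 1"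
  have x: "F $ 1 $ 1 $ 1 $ 1 = x" "F $ (-1) $ (-1) $ (-1) $ (-1) = x"
    using cyc[of 0 0 0 0] cyc[of 1 1 1 1] by (simp_all add: x_def index_3)
  have y: "F $ 1 $ 1 $ (-1) $ (-1) = y" "F $ (-1) $ (-1) $ 0 $ 0 = y"
    using cyc[of 0 0 1 1] cyc[of 1 1 "-1" "-1"] by (simp_all add: y_def index_3)
  then have y': "F $ (-1) $ (-1) $ 1 $ 1 = y" "F $ 0 $ 0 $ (-1) $ (-1) = y" "F $ 1 $ 1 $ 0 $ 0 = y"
    using sym(3) unfolding y_def by metis+
  have z: "F $ 1 $ (-1) $ 1 $ (-1) = z" "F $ (-1) $ 0 $ (-1) $ 0 = z"
    using cyc[of 0 1 0 1] cyc[of 1 "-1" 1 "-1"] by (simp_all add: z_def index_3)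
  have z': "F $ 0 $ 1 $ 1 $ 0 = z" "F $ 1 $ 0 $ 0 $ 1 = z" "F $ 1 $ 0 $ 1 $ 0 = z"
    using sym(1,2) unfolding z_def by metis+
  have x_eq: "x = y + 2 * z"
  proof -
    \<comment> \<open>Signed permutations leave x, y, z independent, so another rotation is
      required; the angle of the 3-4-5 triangle has rational sine and cosine.\<close>
    define g :: "real^3^3" where "g = (\<chi> i j. if i = -1 then (if j = -1 then 1 else 0)
       else if i = 0 then (if j = 0 then 3/5 else if j = 1 then -4/5 else 0)
       else (if j = 0 then 4/5 else if j = 1 then 3/5 else 0))"
    have "orthogonal_matrix g"
      unfolding orthogonal_matrix g_def
      by (simp add: vec_eq_iff transpose_def matrix_matrix_mult_def mat_def sum_index forall_index)
    from inv[OF this] have "x = UU g F $ 0 $ 0 $ 0 $ 0"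
      by (simp add: x_def)
    also have "\<dots> = (81 * x + 256 * x + 288 * y + 576 * z) / 625"
      by (simp add: UU_nth g_def sum_index flip x y' z' x_def[symmetric] y_def[symmetric] z_def[symmetric])
    finally show ?thesis by simp
  qed
  have "0 \<le> z"
  proof -
    \<comment> \<open>A pure shear isolates z. The test with the identity matrix further on bounds 3
      y + 2 z, the weight of \<open>D3\<close>.\<close>
    define e :: tensor2 where "e = (\<chi> i j. if i = 0 \<and> j = 1 \<or> i = 1 \<and> j = 0 then 1 else 0)"
    have "e \<in> S2"
      by (auto simp: S2_def e_def vec_eq_iff transpose_def)
    then have "0 \<le> F \<bullet> tensor_prod e e"
      using F by (simp add: unit_trace_psd_iff)
    also have "\<dots> = 4 * z"
      by (simp add: inner_vec_def tensor_prod_def e_def sum_index z' z_def[symmetric])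
    finally show ?thesis by simp
  qed
  have "0 \<le> 9 * y + 6 * z"
  proof -
    have "mat 1 \<in> S2"
      by (simp add: S2_def)
    then have "0 \<le> F \<bullet> tensor_prod (mat 1) (mat 1)"
      using F by (simp add: unit_trace_psd_iff)
    also have "\<dots> = 9 * y + 6 * z"
      by (simp add: inner_vec_def tensor_prod_def mat_def sum_index x y y' x_def[symmetric] y_def[symmetric], simp add: x_eq)
    finally show ?thesis .
  qed
  have tr: "3 * y + 12 * z = 1"
  proof -
    have "trace (tau F) = 3 * x + 6 * z"
      by (simp add: trace_def sum_6 tau_nth index_pair_simps x x_def[symmetric] z z_def[symmetric])
    then show ?thesis
      using F x_eq by (simp add: unit_trace_psd_def)
  qed
  \<comment> \<open>The functionals \<open>simplex_coord\<close> evaluated with x = y + 2 z; the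
    weights add up to 3 y + 12 z, the trace.\<close>
  define u where "u n = [4 * z, 4 * z, 3 * y + 2 * z, 2 * z, 0] ! (n - 1)" for n :: nat
  have tau: "tau F = (\<Sum>n=1..5. u n *\<^sub>R vertex_matrix n)"
    unfolding sum_1_5
    by (simp add: u_def vec_eq_iff forall_6 vertex_matrix_def D1_def D2_def D3_def D4_def D5_def vector_6
        tau_nth index_pair_simps flip x y y' z x_def[symmetric] y_def[symmetric] z_def[symmetric],
        simp add: x_eq field_simps)
  show "has_simplex_coords (tau F)"
    unfolding tau simplex_iff[symmetric]
  proof (rule simplexI)
    show "0 \<le> u n" if "n \<in> {1..5}" for n
      using that \<open>0 \<le> z\<close> \<open>0 \<le> 9 * y + 6 * z\<close> by (cases rule: in_1_5_cases) (simp_all add: u_def)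
    show "(\<Sum>n=1..5. u n) = 1"
      unfolding sum_1_5 using tr by (simp add: u_def)
  qed
  show "simplex_coord 1 (tau F) = simplex_coord 2 (tau F)"
    "simplex_coord 2 (tau F) = 2 * simplex_coord 4 (tau F)" "simplex_coord 5 (tau F) = 0"
    unfolding tau by (simp_all add: simplex_coord_combination u_def del: One_nat_def)
qed

section \<open>Spherical averages of a density\<close>

lemma iterated_lborel_integral_eq:
  fixes F :: "real \<Rightarrow> real \<Rightarrow> complex"
  assumes "a \<le> b" "c \<le> d" and cont: "continuous_on UNIV (\<lambda>(x, y). F x y)"
  shows "(LBINT x:{a..b}. (LBINT y:{c..d}. F x y)) = integral (cbox (a, c) (b, d)) (\<lambda>(x, y). F x y)"
proof -
  have "continuous_on {c..d} (F x)" for x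
  proof -
    have "continuous_on {c..d} (\<lambda>y. (x, y))"
      by (intro continuous_intros)
    from continuous_on_compose2[OF cont this] show ?thesis by simp
  qed
  then have 1: "(LBINT y:{c..d}. F x y) = integral {c..d} (F x)" for x
    by (intro set_borel_integral_eq_integral borel_integrable_atLeastAtMost')
  have "continuous_on {a..b} (\<lambda>x. integral (cbox c d) (F x))"
    by (rule integral_continuous_on_param) (rule continuous_on_subset[OF cont subset_UNIV])
  then have "(LBINT x:{a..b}. integral {c..d} (F x)) = integral {a..b} (\<lambda>x. integral {c..d} (F x))"
    by (intro set_borel_integral_eq_integral borel_integrable_atLeastAtMost') simp
  then show ?thesis
    unfolding 1 by (subst integral_prod_continuous) (auto intro: continuous_on_subset[OF cont])
qed

definition spectral_kernel :: "nat \<Rightarrow> real \<Rightarrow> vec3 \<Rightarrow> 3 \<Rightarrow> 3 \<Rightarrow> 3 \<Rightarrow> 3 \<Rightarrow> real" where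
  "spectral_kernel n \<rho> r i j k l = (\<Sum>q=1..5. N_tilde n q \<rho> (norm r) * L q r i j k l)"

lemma continuous_vertex_tensor_spherical:
  "continuous_on UNIV (\<lambda>(\<theta>, \<phi>). vertex_tensor n (spherical 1 \<phi> \<theta>) $ i $ j $ k $ l)"
  unfolding split_beta vertex_tensor_nth_expand L_def norm_spherical
  by (simp add: continuous_intros)

text \<open>The vertex tensors are evaluated at the unit direction and not at the wave vector, so
  that the formula includes \<rho> = 0, where the direction is arbitrary.\<close>

lemma spectral_density_spherical:
  assumes f: "spectral_density f" and pole: "f (spherical \<rho> 0 0) = (\<Sum>n=1..5. u n *\<^sub>R vertex_tensor n pole)"
  shows "f (spherical \<rho> \<phi> \<theta>) = (\<Sum>n=1..5. u n *\<^sub>R vertex_tensor n (spherical 1 \<phi> \<theta>))"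
proof -
  have scale: "spherical \<rho> \<phi> \<theta> = \<rho> *\<^sub>R spherical 1 \<phi> \<theta>" for \<phi> \<theta>
    by (simp add: spherical_def vec_eq_iff)
  obtain g where g: "orthogonal_matrix g" "g *v pole = spherical 1 \<phi> \<theta>"
    using ex_orthogonal_pole[of "spherical 1 \<phi> \<theta>"] by (auto simp: norm_spherical)
  have "f (spherical \<rho> \<phi> \<theta>) = f (g *v spherical \<rho> 0 0)"
    unfolding scale[of \<phi> \<theta>] scale[of 0 0] using g by (simp add: matrix_vector_mult_scaleR)
  also have "\<dots> = UU g (f (spherical \<rho> 0 0))"
    using f g by (simp add: spectral_density_def)
  also have "\<dots> = (\<Sum>n=1..5. u n *\<^sub>R vertex_tensor n (spherical 1 \<phi> \<theta>))"
    unfolding pole using g by (simp add: UU_sum UU_scaleR UU_vertex_tensor)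
  finally show ?thesis .
qed

lemma spectral_density_average:
  assumes f: "spectral_density f" and pole: "f (spherical \<rho> 0 0) = (\<Sum>n=1..5. u n *\<^sub>R vertex_tensor n pole)"
    and "\<rho> \<ge> 0"
  shows "1 / (4 * pi) * (LBINT \<theta>:{0..pi}. (LBINT \<phi>:{0..2*pi}.
             exp (\<i> * (spherical \<rho> \<phi> \<theta> \<bullet> r)) * f (spherical \<rho> \<phi> \<theta>) $ i $ j $ k $ l * sin \<theta>)) =
    complex_of_real (\<Sum>n=1..5. u n * spectral_kernel n \<rho> r i j k l)"
proof -
  define w where "w \<omega> = (\<Sum>n=1..5. u n * vertex_tensor n \<omega> $ i $ j $ k $ l)" for \<omega>
  have eq: "exp (\<i> * (spherical \<rho> \<phi> \<theta> \<bullet> r)) * f (spherical \<rho> \<phi> \<theta>) $ i $ j $ k $ l * sin \<theta> =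
      (sin \<theta> * w (spherical 1 \<phi> \<theta>)) *\<^sub>R cis (spherical 1 \<phi> \<theta> \<bullet> (\<rho> *\<^sub>R r))" for \<phi> \<theta>
  proof -
    \<comment> \<open>The radius is moved from the wave vector to r, so that means over the unit
      sphere serve every \<rho>.\<close>
    have "spherical \<rho> \<phi> \<theta> \<bullet> r = spherical 1 \<phi> \<theta> \<bullet> (\<rho> *\<^sub>R r)"
      by (simp add: spherical_def inner_vec3 algebra_simps)
    then show ?thesis
      unfolding spectral_density_spherical[OF f pole] w_def cis_conv_exp
      by (simp add: scaleR_conv_of_real[where ?'a = complex] mult_ac)
  qed
  have avg: "has_sphere_avg w (\<rho> *\<^sub>R r) (complex_of_real (\<Sum>n=1..5. u n * spectral_kernel n \<rho> r i j k l))"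
  proof -
    have "has_sphere_avg w (\<rho> *\<^sub>R r) (\<Sum>n=1..5. of_real (u n) * of_real (spectral_kernel n \<rho> r i j k l))"
      unfolding w_def spectral_kernel_def
      by (intro has_sphere_avg_sum has_sphere_avg_cmul has_sphere_avg_vertex_tensor) (use \<open>\<rho> \<ge> 0\<close> in auto)
    then show ?thesis by simp
  qed
  have "continuous_on UNIV (\<lambda>x. w (spherical 1 (snd x) (fst x)))"
    unfolding w_def
    by (intro continuous_on_sum continuous_on_mult continuous_on_const
        continuous_vertex_tensor_spherical[unfolded split_beta])
  then have "continuous_on UNIV (\<lambda>(\<theta>, \<phi>). (sin \<theta> * w (spherical 1 \<phi> \<theta>)) *\<^sub>R cis (spherical 1 \<phi> \<theta> \<bullet> (\<rho> *\<^sub>R r)))"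
    unfolding split_beta by (intro continuous_intros)
  then have "(LBINT \<theta>:{0..pi}. (LBINT \<phi>:{0..2*pi}.
      (sin \<theta> * w (spherical 1 \<phi> \<theta>)) *\<^sub>R cis (spherical 1 \<phi> \<theta> \<bullet> (\<rho> *\<^sub>R r)))) =
      integral sphere_box (\<lambda>(\<theta>, \<phi>). (sin \<theta> * w (spherical 1 \<phi> \<theta>)) *\<^sub>R cis (spherical 1 \<phi> \<theta> \<bullet> (\<rho> *\<^sub>R r)))"
    by (intro iterated_lborel_integral_eq) auto
  also have "\<dots> = (4 * pi) *\<^sub>R complex_of_real (\<Sum>n=1..5. u n * spectral_kernel n \<rho> r i j k l)"
    using avg unfolding has_sphere_avg_def by (rule integral_unique)
  finally show ?thesis
    unfolding eq by (simp add: scaleR_conv_of_real)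
qed

lemma continuous_spectral_kernel:
  assumes "n \<in> {1..5}"
  shows "continuous_on {0..} (\<lambda>\<rho>. spectral_kernel n \<rho> r i j k l)"
proof -
  have bessel: "continuous_on {0..} (\<lambda>\<rho>. spherical_bessel m (\<rho> * norm r))" for m
  proof (rule continuous_on_cong[THEN iffD2, OF refl])
    show "spherical_bessel m (\<rho> * norm r) = (\<rho> * norm r)^m * bessel_series m ((\<rho> * norm r)\<^sup>2)"
      if "\<rho> \<in> {0..}" for \<rho>
      using that by (simp add: spherical_bessel_eq)
  qed (intro continuous_intros)
  show ?thesis
    using assms unfolding spectral_kernel_def sum_1_5
    by (cases rule: in_1_5_cases)
       (auto simp: N_tilde_def Let_def intro!: continuous_intros bessel)
qed

text \<open>The kernel is a mean of a weight against waves of modulus one, and the weight is bounded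
  because the parameter box is compact.\<close>

lemma bounded_spectral_kernel:
  assumes "n \<in> {1..5}"
  obtains B where "\<And>\<rho>. \<rho> \<ge> 0 \<Longrightarrow> \<bar>spectral_kernel n \<rho> r i j k l\<bar> \<le> B"
proof -
  have "compact ((\<lambda>(\<theta>, \<phi>). vertex_tensor n (spherical 1 \<phi> \<theta>) $ i $ j $ k $ l) ` sphere_box)"
    by (intro compact_continuous_image continuous_on_subset[OF continuous_vertex_tensor_spherical]) auto
  then have "bounded ((\<lambda>(\<theta>, \<phi>). vertex_tensor n (spherical 1 \<phi> \<theta>) $ i $ j $ k $ l) ` sphere_box)"
    by (rule compact_imp_bounded)
  then obtain C where "C > 0" and *: "\<forall>x\<in>(\<lambda>(\<theta>, \<phi>). vertex_tensor n (spherical 1 \<phi> \<theta>) $ i $ j $ k $ l) ` sphere_box. norm x \<le> C"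
    unfolding bounded_pos by blast
  have C: "\<bar>vertex_tensor n (spherical 1 (snd x) (fst x)) $ i $ j $ k $ l\<bar> \<le> C" if "x \<in> sphere_box" for x
    using bspec[OF * imageI[OF that]] by (simp add: split_beta)
  have "\<bar>spectral_kernel n \<rho> r i j k l\<bar> \<le> C * measure lborel sphere_box / (4 * pi)" if "\<rho> \<ge> 0" for \<rho>
  proof -
    have "norm ((4 * pi) *\<^sub>R complex_of_real (spectral_kernel n \<rho> r i j k l)) \<le> C * measure lborel sphere_box"
      using has_sphere_avg_vertex_tensor[OF that assms, of i j k l r]
      unfolding spectral_kernel_def has_sphere_avg_def
    proof (rule has_integral_bound[rotated])
      fix x :: "real \<times> real"
      assume "x \<in> sphere_box"
      then show "norm (case x of (\<theta>, \<phi>) \<Rightarrow> (sin \<theta> * vertex_tensor n (spherical 1 \<phi> \<theta>) $ i $ j $ k $ l) *\<^sub>R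
          cis (spherical 1 \<phi> \<theta> \<bullet> (\<rho> *\<^sub>R r))) \<le> C"
        using mult_mono[OF abs_sin_le_one C, of x "fst x"] by (simp add: split_beta abs_mult)
    qed (use \<open>C > 0\<close> in simp)
    then show ?thesis
      by (simp add: field_simps)
  qed
  then show ?thesis by (rule that)
qed

section \<open>Measures on the half-line\<close>

lemma borel_measurable_vecI:
  fixes f :: "'a \<Rightarrow> 'b::euclidean_space ^ 'n"
  assumes "\<And>i. (\<lambda>x. f x $ i) \<in> borel_measurable M"
  shows "f \<in> borel_measurable M"
  unfolding borel_measurable_euclidean_space[of f]
  using assms by (auto simp: Basis_vec_def inner_axis)

lemma borel_measurable_vec_nth:
  fixes f :: "'a \<Rightarrow> 'b::euclidean_space ^ 'n"
  shows "f \<in> borel_measurable M \<Longrightarrow> (\<lambda>x. f x $ i) \<in> borel_measurable M"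
  by (rule borel_measurable_continuous_on[of "\<lambda>x. x $ i"]) (auto intro: continuous_intros)

lemma space_halfline: "finite_measure_on_halfline \<mu> \<Longrightarrow> space \<mu> = {0..}"
  using sets_eq_imp_space_eq[of \<mu> "restrict_space borel {0..}"]
  by (simp add: finite_measure_on_halfline_def space_restrict_space)

lemma halfline_sets_0: "finite_measure_on_halfline \<mu> \<Longrightarrow> {0} \<in> sets \<mu>"
  by (simp add: finite_measure_on_halfline_def sets_restrict_space_iff)

lemma measurable_halfline:
  "finite_measure_on_halfline \<mu> \<Longrightarrow> measurable \<mu> N = measurable (restrict_space borel {0..}) N"
  by (rule measurable_cong_sets) (simp_all add: finite_measure_on_halfline_def)

lemma emeasure_density_singleton:
  assumes "g \<in> borel_measurable \<mu>" "{x} \<in> sets \<mu>"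
  shows "emeasure (density \<mu> g) {x} = g x * emeasure \<mu> {x}"
proof -
  have "emeasure (density \<mu> g) {x} = (\<integral>\<^sup>+y. g x * indicator {x} y \<partial>\<mu>)"
    unfolding emeasure_density[OF assms] by (rule nn_integral_cong) (simp split: split_indicator)
  also have "\<dots> = g x * emeasure \<mu> {x}"
    by (rule nn_integral_cmult_indicator) (rule assms(2))
  finally show ?thesis .
qed

lemma finite_measure_on_halfline_density:
  assumes \<mu>: "finite_measure_on_halfline \<mu>" and u: "u \<in> borel_measurable \<mu>"
    and le: "\<And>\<rho>. \<rho> \<ge> 0 \<Longrightarrow> u \<rho> \<le> (1::real)"
  shows "finite_measure_on_halfline (density \<mu> u)"
proof -
  interpret finite_measure \<mu>
    using \<mu> by (simp add: finite_measure_on_halfline_def)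
  have "emeasure (density \<mu> u) (space \<mu>) = (\<integral>\<^sup>+\<rho>. ennreal (u \<rho>) \<partial>\<mu>)"
    using u by (subst emeasure_density) (auto intro!: nn_integral_cong)
  also have "\<dots> \<le> (\<integral>\<^sup>+\<rho>. 1 \<partial>\<mu>)"
    by (rule nn_integral_mono) (use le space_halfline[OF \<mu>] in \<open>simp add: ennreal_le_1\<close>)
  also have "\<dots> < \<infinity>"
    by (simp add: less_top[symmetric])
  finally have "finite_measure (density \<mu> u)"
    by (intro finite_measureI) (simp add: less_top)
  then show ?thesis
    using \<mu> by (simp add: finite_measure_on_halfline_def)
qed

lemma integrable_spectral_kernel:
  assumes \<mu>: "finite_measure_on_halfline \<mu>" and n: "n \<in> {1..5}"
  shows "integrable \<mu> (\<lambda>\<rho>. spectral_kernel n \<rho> r i j k l)"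
proof -
  interpret finite_measure \<mu>
    using \<mu> by (simp add: finite_measure_on_halfline_def)
  obtain B where B: "\<And>\<rho>. \<rho> \<ge> 0 \<Longrightarrow> \<bar>spectral_kernel n \<rho> r i j k l\<bar> \<le> B"
    using bounded_spectral_kernel[OF n, of r i j k l] by blast
  have "(\<lambda>\<rho>. spectral_kernel n \<rho> r i j k l) \<in> borel_measurable \<mu>"
    unfolding measurable_halfline[OF \<mu>]
    by (intro borel_measurable_continuous_on_restrict continuous_spectral_kernel n)
  then show ?thesis
    by (intro integrable_const_bound[of _ B] AE_I2) (use B space_halfline[OF \<mu>] in auto)
qed

text \<open>Serves both implications: the weights on the axis determine f on every sphere, and the
  integral over \<nu> splits into five. Since the weights are nonnegative with sum 1, each is at
  most 1 and the new measures stay finite.\<close>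

lemma spectral_representation:
  assumes \<nu>: "finite_measure_on_halfline \<nu>" and f: "spectral_density f"
    and meas: "\<And>n. n \<in> {1..5} \<Longrightarrow> u n \<in> borel_measurable \<nu>"
    and nonneg: "\<And>n \<rho>. n \<in> {1..5} \<Longrightarrow> \<rho> \<ge> 0 \<Longrightarrow> 0 \<le> u n \<rho>"
    and sum1: "\<And>\<rho>. \<rho> \<ge> 0 \<Longrightarrow> (\<Sum>n=1..5. u n \<rho>) = 1"
    and pole: "\<And>\<rho>. \<rho> \<ge> 0 \<Longrightarrow> f (spherical \<rho> 0 0) = (\<Sum>n=1..5. u n \<rho> *\<^sub>R vertex_tensor n pole)"
  shows "1 / (4 * pi) * (LINT \<rho>|\<nu>. (LBINT \<theta>:{0..pi}. (LBINT \<phi>:{0..2*pi}.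
             exp (\<i> * (spherical \<rho> \<phi> \<theta> \<bullet> r)) * f (spherical \<rho> \<phi> \<theta>) $ i $ j $ k $ l * sin \<theta>))) =
    complex_of_real (\<Sum>n=1..5. LINT \<rho>|density \<nu> (u n). spectral_kernel n \<rho> r i j k l)"
    and "n \<in> {1..5} \<Longrightarrow> finite_measure_on_halfline (density \<nu> (u n))"
proof -
  have le: "u n \<rho> \<le> 1" if "n \<in> {1..5}" "\<rho> \<ge> 0" for n \<rho>
    using member_le_sum[of n "{1..5}" "\<lambda>n. u n \<rho>"] nonneg sum1[OF that(2)] that by simp
  then show fin: "finite_measure_on_halfline (density \<nu> (u n))" if "n \<in> {1..5}" for n
    using finite_measure_on_halfline_density[OF \<nu> meas[OF that]] that by blast
  have dens: "AE \<rho> in \<nu>. 0 \<le> u n \<rho>" if "n \<in> {1..5}" for n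
    using nonneg[OF that] space_halfline[OF \<nu>] by (intro AE_I2) simp
  have km: "(\<lambda>\<rho>. spectral_kernel n \<rho> r i j k l) \<in> borel_measurable \<nu>" if "n \<in> {1..5}" for n
    using integrable_spectral_kernel[OF \<nu> that] by (rule borel_measurable_integrable)
  have "1 / (4 * pi) * (LINT \<rho>|\<nu>. (LBINT \<theta>:{0..pi}. (LBINT \<phi>:{0..2*pi}.
             exp (\<i> * (spherical \<rho> \<phi> \<theta> \<bullet> r)) * f (spherical \<rho> \<phi> \<theta>) $ i $ j $ k $ l * sin \<theta>))) =
      (LINT \<rho>|\<nu>. 1 / (4 * pi) * (LBINT \<theta>:{0..pi}. (LBINT \<phi>:{0..2*pi}.
             exp (\<i> * (spherical \<rho> \<phi> \<theta> \<bullet> r)) * f (spherical \<rho> \<phi> \<theta>) $ i $ j $ k $ l * sin \<theta>)))"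
    by simp
  also have "\<dots> = (LINT \<rho>|\<nu>. complex_of_real (\<Sum>n=1..5. u n \<rho> * spectral_kernel n \<rho> r i j k l))"
    by (rule Bochner_Integration.integral_cong[OF refl], rule spectral_density_average)
       (use f pole space_halfline[OF \<nu>] in auto)
  also have "\<dots> = complex_of_real (\<Sum>n=1..5. LINT \<rho>|\<nu>. u n \<rho> * spectral_kernel n \<rho> r i j k l)"
    unfolding integral_complex_of_real
  proof (subst Bochner_Integration.integral_sum)
    show "integrable \<nu> (\<lambda>\<rho>. u n \<rho> * spectral_kernel n \<rho> r i j k l)" if "n \<in> {1..5}" for n
      using integrable_spectral_kernel[OF fin[OF that] that, of r i j k l]
        integrable_real_density[OF meas[OF that] dens[OF that] km[OF that]] by simp
  qed simp
  also have "\<dots> = complex_of_real (\<Sum>n=1..5. LINT \<rho>|density \<nu> (u n). spectral_kernel n \<rho> r i j k l)"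
    by (intro arg_cong[of _ _ complex_of_real] sum.cong refl)
       (simp add: integral_real_density[OF meas dens km])
  finally show "1 / (4 * pi) * (LINT \<rho>|\<nu>. (LBINT \<theta>:{0..pi}. (LBINT \<phi>:{0..2*pi}.
             exp (\<i> * (spherical \<rho> \<phi> \<theta> \<bullet> r)) * f (spherical \<rho> \<phi> \<theta>) $ i $ j $ k $ l * sin \<theta>))) =
    complex_of_real (\<Sum>n=1..5. LINT \<rho>|density \<nu> (u n). spectral_kernel n \<rho> r i j k l)" .
qed

section \<open>A common dominating measure and its Radon-Nikodym derivatives\<close>

lemma ex_sum_measure:
  assumes "finite A" and fin: "\<And>n. n \<in> A \<Longrightarrow> finite_measure (\<Phi> n)"
    and sets: "\<And>n. n \<in> A \<Longrightarrow> sets (\<Phi> n) = sets N"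
  obtains \<nu> where "finite_measure \<nu>" "sets \<nu> = sets N"
    "\<And>X. X \<in> sets N \<Longrightarrow> emeasure \<nu> X = (\<Sum>n\<in>A. emeasure (\<Phi> n) X)"
proof -
  define \<nu> where "\<nu> = measure_of (space N) (sets N) (\<lambda>X. \<Sum>n\<in>A. emeasure (\<Phi> n) X)"
  have s: "sets \<nu> = sets N" "space \<nu> = space N"
    by (simp_all add: \<nu>_def)
  have e: "emeasure \<nu> X = (\<Sum>n\<in>A. emeasure (\<Phi> n) X)" if "X \<in> sets N" for X
    unfolding \<nu>_def
  proof (rule emeasure_measure_of_sigma)
    show "sigma_algebra (space N) (sets N)" ..
    show "positive (sets N) (\<lambda>X. \<Sum>n\<in>A. emeasure (\<Phi> n) X)"
      by (simp add: positive_def)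
    show "countably_additive (sets N) (\<lambda>X. \<Sum>n\<in>A. emeasure (\<Phi> n) X)"
    proof (rule countably_additiveI)
      fix X :: "nat \<Rightarrow> _"
      assume X: "range X \<subseteq> sets N" "disjoint_family X"
      have "(\<Sum>i. \<Sum>n\<in>A. emeasure (\<Phi> n) (X i)) = (\<Sum>n\<in>A. \<Sum>i. emeasure (\<Phi> n) (X i))"
        by (rule suminf_sum) simp
      also have "\<dots> = (\<Sum>n\<in>A. emeasure (\<Phi> n) (\<Union>i. X i))"
        using X sets by (intro sum.cong suminf_emeasure refl) auto
      finally show "(\<Sum>i. \<Sum>n\<in>A. emeasure (\<Phi> n) (X i)) = (\<Sum>n\<in>A. emeasure (\<Phi> n) (\<Union>i. X i))" .
    qed
  qed (rule that)
  have "emeasure \<nu> (space \<nu>) < \<top>"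
    using assms(1) finite_measure.emeasure_finite[OF fin]
    unfolding s(2) e[OF sets.top] by (simp add: less_top)
  then have "emeasure \<nu> (space \<nu>) \<noteq> \<infinity>"
    by simp
  then have "finite_measure \<nu>" ..
  then show ?thesis
    using s e that by blast
qed

text \<open>The derivatives obtained from the Radon-Nikodym theorem have sum 1 only almost
  everywhere. They are altered on a null set so that the sum and the relations at 0 hold at every
  point, as a density with unit trace and equivariance requires.\<close>

lemma ex_common_densities:
  fixes \<Phi> :: "nat \<Rightarrow> real measure"
  assumes \<Phi>: "\<And>n. n \<in> {1..5} \<Longrightarrow> finite_measure_on_halfline (\<Phi> n)"
    and atoms: "measure (\<Phi> 1) {0} = measure (\<Phi> 2) {0}" "measure (\<Phi> 2) {0} = 2 * measure (\<Phi> 4) {0}"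
      "measure (\<Phi> 5) {0} = 0"
  shows "\<exists>\<nu> (u :: nat \<Rightarrow> real \<Rightarrow> real). finite_measure_on_halfline \<nu> \<and>
    (\<forall>n\<in>{1..5}. u n \<in> borel_measurable \<nu> \<and> density \<nu> (\<lambda>\<rho>. ennreal (u n \<rho>)) = \<Phi> n) \<and>
    (\<forall>n \<rho>. 0 \<le> u n \<rho>) \<and> (\<forall>\<rho>. (\<Sum>n=1..5. u n \<rho>) = 1) \<and>
    u 1 0 = u 2 0 \<and> u 2 0 = 2 * u 4 0 \<and> u 5 0 = 0"
proof -
  obtain \<nu> where fin: "finite_measure \<nu>" and sets: "sets \<nu> = sets (restrict_space borel {0..})"
    and \<nu>: "\<And>X. X \<in> sets (restrict_space borel {0..}) \<Longrightarrow> emeasure \<nu> X = (\<Sum>n\<in>{1..5}. emeasure (\<Phi> n) X)"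
    using ex_sum_measure[of "{1..5}" \<Phi> "restrict_space borel {0..}"] \<Phi>
    unfolding finite_measure_on_halfline_def by auto
  interpret finite_measure \<nu> by (rule fin)
  have halfline: "finite_measure_on_halfline \<nu>"
    using fin sets by (simp add: finite_measure_on_halfline_def)
  have \<Phi>_sets: "sets (\<Phi> n) = sets \<nu>" if "n \<in> {1..5}" for n
    using \<Phi>[OF that] sets by (simp add: finite_measure_on_halfline_def)
  have "\<exists>h\<in>borel_measurable \<nu>. density \<nu> h = \<Phi> n" if "n \<in> {1..5}" for n
  proof (rule Radon_Nikodym)
    show "absolutely_continuous \<nu> (\<Phi> n)"
    proof (unfold absolutely_continuous_def, safe)
      fix X assume "X \<in> null_sets \<nu>"
      then have "emeasure (\<Phi> n) X = 0" "X \<in> sets \<nu>"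
        using \<nu>[of X] that sets by (auto simp: null_sets_def)
      then show "X \<in> null_sets (\<Phi> n)"
        using \<Phi>_sets[OF that] by (simp add: null_sets_def)
    qed
  qed (rule \<Phi>_sets[OF that])
  then obtain h where h_meas: "\<And>n. n \<in> {1..5} \<Longrightarrow> h n \<in> borel_measurable \<nu>"
    and h: "\<And>n. n \<in> {1..5} \<Longrightarrow> density \<nu> (h n) = \<Phi> n"
    by metis
  have sum_meas: "(\<lambda>\<rho>. \<Sum>n\<in>{1..5}. h n \<rho>) \<in> borel_measurable \<nu>"
    using h_meas by (rule borel_measurable_sum)
  \<comment> \<open>The sum of the derivatives is a density of \<nu> with respect to itself, and
    densities are unique almost everywhere.\<close>
  have sum_h: "AE \<rho> in \<nu>. (\<Sum>n\<in>{1..5}. h n \<rho>) = 1"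
  proof (rule density_unique)
    show "density \<nu> (\<lambda>\<rho>. \<Sum>n\<in>{1..5}. h n \<rho>) = density \<nu> (\<lambda>_. 1)"
    proof (rule measure_eqI)
      fix X assume "X \<in> sets (density \<nu> (\<lambda>\<rho>. \<Sum>n\<in>{1..5}. h n \<rho>))"
      then have X: "X \<in> sets \<nu>" by simp
      have "emeasure (density \<nu> (\<lambda>\<rho>. \<Sum>n\<in>{1..5}. h n \<rho>)) X = (\<Sum>n\<in>{1..5}. \<integral>\<^sup>+\<rho>. h n \<rho> * indicator X \<rho> \<partial>\<nu>)"
        unfolding emeasure_density[OF sum_meas X] sum_distrib_right
        by (rule nn_integral_sum) (use X h_meas in \<open>intro borel_measurable_times_ennreal borel_measurable_indicator; simp\<close>)
      also have "\<dots> = (\<Sum>n\<in>{1..5}. emeasure (\<Phi> n) X)"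
        using X h_meas by (intro sum.cong refl) (simp add: h[symmetric] emeasure_density)
      also have "\<dots> = emeasure (density \<nu> (\<lambda>_. 1)) X"
        using X sets by (simp add: \<nu> density_1)
      finally show "emeasure (density \<nu> (\<lambda>\<rho>. \<Sum>n\<in>{1..5}. h n \<rho>)) X = emeasure (density \<nu> (\<lambda>_. 1)) X" .
    qed simp
  qed (use h_meas in auto)
  define atom_cond where "atom_cond \<longleftrightarrow> enn2real (h 1 0) = enn2real (h 2 0) \<and>
      enn2real (h 2 0) = 2 * enn2real (h 4 0) \<and> enn2real (h 5 0) = 0"
  \<comment> \<open>If \<nu> charges 0, dividing the masses of the atoms by that of \<nu> gives the
    relations for the derivatives; otherwise the point 0 is negligible.\<close>
  have at_0: "AE \<rho> in \<nu>. \<rho> = 0 \<longrightarrow> atom_cond"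
  proof (cases "emeasure \<nu> {0} = 0")
    case True
    then have "{0} \<in> null_sets \<nu>"
      using halfline_sets_0[OF halfline] by auto
    from AE_not_in[OF this] show ?thesis by eventually_elim simp
  next
    case False
    have "measure (\<Phi> n) {0} = enn2real (h n 0) * measure \<nu> {0}" if "n \<in> {1..5}" for n
      using emeasure_density_singleton[OF h_meas[OF that] halfline_sets_0[OF halfline]]
      by (simp add: h[OF that] measure_def enn2real_mult)
    moreover have "measure \<nu> {0} \<noteq> 0"
      using False by (simp add: emeasure_eq_measure)
    ultimately have atom_cond
      using atoms by (simp add: atom_cond_def)
    then show ?thesis by simp
  qed
  define good where "good \<rho> \<longleftrightarrow> (\<Sum>n\<in>{1..5}. h n \<rho>) = 1 \<and> (\<rho> = 0 \<longrightarrow> atom_cond)" for \<rho>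
  \<comment> \<open>Off the good set all weight goes to \<open>D3\<close>, whose tensor is invariant
    under O(3); this default satisfies the relations required at 0.\<close>
  define u where "u n \<rho> = (if good \<rho> then enn2real (h n \<rho>) else if n = 3 then 1 else 0)" for n \<rho>
  \<comment> \<open>A sum equal to 1 keeps each term finite, so \<open>enn2real\<close> loses
    nothing.\<close>
  have finite_h: "h n \<rho> \<noteq> \<infinity>" if "good \<rho>" "n \<in> {1..5}" for n \<rho>
    using member_le_sum[of n "{1..5}" "\<lambda>n. h n \<rho>"] that by (auto simp: good_def top_unique)
  have meas_0: "(\<lambda>\<rho>::real. \<rho> = 0) \<in> measurable \<nu> (count_space UNIV)"
    unfolding measurable_halfline[OF halfline] by (rule measurable_restrict_space1) measurable
  have good_meas: "good \<in> measurable \<nu> (count_space UNIV)"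
    unfolding good_def[abs_def] using meas_0 sum_meas by measurable
  have u_meas: "u n \<in> borel_measurable \<nu>" if "n \<in> {1..5}" for n
    unfolding u_def[abs_def] using good_meas h_meas[OF that] by measurable
  have "density \<nu> (u n) = \<Phi> n" if n: "n \<in> {1..5}" for n
  proof -
    have "AE \<rho> in \<nu>. ennreal (u n \<rho>) = h n \<rho>"
      using sum_h at_0
    proof eventually_elim
      case (elim \<rho>)
      then have "good \<rho>" by (simp add: good_def)
      with finite_h[OF this n] show ?case
        by (simp add: u_def ennreal_enn2real_if)
    qed
    then have "density \<nu> (u n) = density \<nu> (h n)"
      by (intro density_cong) (use u_meas h_meas n in auto)
    then show ?thesis using h[OF n] by simp
  qed
  moreover have "0 \<le> u n \<rho>" for n \<rho>
    by (simp add: u_def)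
  moreover have "(\<Sum>n=1..5. u n \<rho>) = 1" for \<rho>
  proof (cases "good \<rho>")
    case True
    have "(\<Sum>n=1..5. u n \<rho>) = enn2real (\<Sum>n=1..5. h n \<rho>)"
      using finite_h[OF True] by (subst enn2real_sum) (auto simp: u_def True less_top)
    with True show ?thesis by (simp add: good_def)
  next
    case False
    then show ?thesis
      unfolding sum_1_5 by (simp add: u_def)
  qed
  moreover have "u 1 0 = u 2 0 \<and> u 2 0 = 2 * u 4 0 \<and> u 5 0 = 0"
    by (auto simp: u_def good_def atom_cond_def)
  ultimately show ?thesis
    using halfline u_meas by blast
qed

section \<open>Spectral expansions\<close>

lemma spherical_0: "spherical 0 \<phi> \<theta> = 0"
  by (simp add: spherical_def vec_eq_iff)

lemma spherical_pole: "spherical \<rho> 0 0 = \<rho> *\<^sub>R pole"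
  by (simp add: spherical_def vec_eq_iff)

lemma borel_measurable_simplex_coord:
  assumes "f \<in> borel_measurable borel" "n \<in> {1..5}"
  shows "(\<lambda>\<rho>. simplex_coord n (tau (f (spherical \<rho> 0 0)))) \<in> borel_measurable borel"
proof -
  have "(\<lambda>\<rho>. spherical \<rho> 0 0) \<in> borel_measurable borel"
    by (intro borel_measurable_continuous_onI continuous_intros)
  then have "(\<lambda>\<rho>. f (spherical \<rho> 0 0)) \<in> borel_measurable borel"
    using assms(1) by (rule measurable_compose)
  then have [measurable]: "(\<lambda>\<rho>. tau (f (spherical \<rho> 0 0)) $ a $ b) \<in> borel_measurable borel" for a b
    unfolding tau_nth by (intro borel_measurable_times borel_measurable_const borel_measurable_vec_nth)
  show ?thesis
    using assms(2) by (cases rule: in_1_5_cases) (simp_all add: simplex_coord_def)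
qed

section \<open>An equivariant density with prescribed weights\<close>

lemma borel_measurable_vertex_tensor: "(\<lambda>p. vertex_tensor n p $ i $ j $ k $ l) \<in> borel_measurable borel"
proof -
  have [measurable]: "(\<lambda>p::vec3. p $ a) \<in> borel_measurable borel" for a
    by (intro borel_measurable_continuous_onI continuous_intros)
  show ?thesis
    unfolding vertex_tensor_nth_expand L_def by simp
qed

text \<open>Taking the pole in place of 0 keeps every summand in \<open>unit_trace_psd\<close>. The
  direction is arbitrary: under the relations at 0 the sum does not depend on it, by
  \<open>isotropic_combination\<close>.\<close>

definition axial_density :: "(nat \<Rightarrow> real \<Rightarrow> real) \<Rightarrow> vec3 \<Rightarrow> tensor4" where
  "axial_density u p = (\<Sum>n=1..5. u n (norm p) *\<^sub>R vertex_tensor n (if p = 0 then pole else p))"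

lemma axial_density_pole:
  assumes "\<rho> \<ge> 0"
  shows "axial_density u (spherical \<rho> 0 0) = (\<Sum>n=1..5. u n \<rho> *\<^sub>R vertex_tensor n pole)"
proof (cases "\<rho> = 0")
  case False
  have "pole \<noteq> 0"
    using norm_pole by (metis norm_zero zero_neq_one)
  with False assms show ?thesis
    unfolding spherical_pole[of \<rho>]
    by (simp add: axial_density_def norm_pole vertex_tensor_scaleR del: One_nat_def)
qed (simp add: axial_density_def spherical_0)

lemma spectral_density_axial:
  assumes meas: "\<And>n. n \<in> {1..5} \<Longrightarrow> u n \<in> borel_measurable (restrict_space borel {0..})"
    and nonneg: "\<And>n \<rho>. 0 \<le> u n \<rho>" and sum1: "\<And>\<rho>. (\<Sum>n=1..5. u n \<rho>) = 1"
    and at_0: "u 1 0 = u 2 0" "u 2 0 = 2 * u 4 0" "u 5 0 = 0"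
  shows "spectral_density (axial_density u)"
  unfolding spectral_density_def
proof (intro conjI allI impI)
  have "(\<lambda>p. axial_density u p $ i $ j $ k $ l) \<in> borel_measurable borel" for i j k l
  proof -
    have "(\<lambda>p. u n (norm p) * vertex_tensor n (if p = 0 then pole else p) $ i $ j $ k $ l) \<in> borel_measurable borel"
      if "n \<in> {1..5}" for n
    proof (rule borel_measurable_times)
      have "(norm :: vec3 \<Rightarrow> real) \<in> measurable borel (restrict_space borel {0..})"
        by (rule measurable_restrict_space2) auto
      from measurable_compose[OF this meas[OF that]]
      show "(\<lambda>p::vec3. u n (norm p)) \<in> borel_measurable borel" .
      have "(\<lambda>p::vec3. if p = 0 then pole else p) \<in> borel_measurable borel"
        by measurable
      from measurable_compose[OF this borel_measurable_vertex_tensor]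
      show "(\<lambda>p. vertex_tensor n (if p = 0 then pole else p) $ i $ j $ k $ l) \<in> borel_measurable borel" .
    qed
    then show ?thesis
      by (simp add: axial_density_def del: One_nat_def)
  qed
  then show "axial_density u \<in> borel_measurable borel"
    by (intro borel_measurable_vecI)
  fix p
  have "pole \<noteq> 0"
    using norm_pole by (metis norm_zero zero_neq_one)
  then show "axial_density u p \<in> unit_trace_psd"
    unfolding axial_density_def using nonneg sum1
    by (intro unit_trace_psd_combination vertex_tensor_psd) auto
next
  fix g p
  assume g: "orthogonal_matrix (g :: real^3^3)"
  have UU: "UU g (axial_density u p) =
      (\<Sum>n=1..5. u n (norm p) *\<^sub>R vertex_tensor n (g *v (if p = 0 then pole else p)))"
    using g by (simp add: axial_density_def UU_sum UU_scaleR UU_vertex_tensor)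
  show "axial_density u (g *v p) = UU g (axial_density u p)"
  \<comment> \<open>g fixes 0 but may move the pole, so equivariance at the origin rests on the
    relations between the weights at 0.\<close>
  proof (cases "p = 0")
    case True
    have "(\<Sum>n=1..5. u n 0 *\<^sub>R vertex_tensor n pole) = (\<Sum>n=1..5. u n 0 *\<^sub>R vertex_tensor n (g *v pole))"
      by (rule isotropic_combination) (rule at_0)+
    with True show ?thesis
      unfolding UU by (simp add: axial_density_def)
  next
    case False
    then have "g *v p \<noteq> 0"
      using norm_orthogonal_matrix[OF g, of p] by (metis norm_eq_zero)
    with False show ?thesis
      unfolding UU by (simp add: axial_density_def norm_orthogonal_matrix[OF g])
  qed
qed

lemma measure_density_singleton:
  assumes "finite_measure \<mu>" "u \<in> borel_measurable \<mu>" "{x} \<in> sets \<mu>" "0 \<le> u x"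
  shows "measure (density \<mu> u) {x} = u x * measure \<mu> {x}"
proof -
  interpret finite_measure \<mu> by (rule assms)
  have "(\<lambda>x. ennreal (u x)) \<in> borel_measurable \<mu>"
    using assms by simp
  from emeasure_density_singleton[OF this assms(3)] show ?thesis
    using assms(4) by (simp add: measure_def enn2real_mult)
qed

section \<open>The two implications\<close>

lemma expansion_of_spectral_density:
  fixes R :: "vec3 \<Rightarrow> vec3 \<Rightarrow> tensor4"
  assumes \<nu>: "finite_measure_on_halfline \<nu>" and f: "spectral_density f"
    and R: "\<And>x y i j k l. complex_of_real (R x y $ i $ j $ k $ l) =
           1 / (4 * pi) * (LINT \<rho>|\<nu>. (LBINT \<theta>:{0..pi}. (LBINT \<phi>:{0..2*pi}.
             exp (\<i> * (spherical \<rho> \<phi> \<theta> \<bullet> (y - x))) * f (spherical \<rho> \<phi> \<theta>) $ i $ j $ k $ l * sin \<theta>)))"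
    and simplex: "\<And>\<rho>. \<rho> > 0 \<Longrightarrow> tau (f (spherical \<rho> 0 0)) \<in> convex hull {D1, D2, D3, D4, D5}"
  shows "\<exists>\<Phi>. (\<forall>n\<in>{1..5::nat}. finite_measure_on_halfline (\<Phi> n)) \<and>
        measure (\<Phi> 1) {0} = measure (\<Phi> 2) {0} \<and>
        measure (\<Phi> 2) {0} = 2 * measure (\<Phi> 4) {0} \<and>
        measure (\<Phi> 5) {0} = 0 \<and>
        (\<forall>x y i j k l. R x y $ i $ j $ k $ l =
           (\<Sum>n=1..5. LINT \<rho>|\<Phi> n. spectral_kernel n \<rho> (y - x) i j k l))"
proof -
  define u where "u n \<rho> = simplex_coord n (tau (f (spherical \<rho> 0 0)))" for n \<rho>
  have psd: "f p \<in> unit_trace_psd" for p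
    using f by (simp add: spectral_density_def)
  \<comment> \<open>Every g fixes the origin, so f(0) is an isotropic tensor.\<close>
  have "UU g (f 0) = f 0" if "orthogonal_matrix g" for g
    using f that unfolding spectral_density_def by (metis matrix_vector_mult_0_right)
  note at_0 = simplex_coords_isotropic[OF psd this]
  have u_0: "u 1 0 = u 2 0" "u 2 0 = 2 * u 4 0" "u 5 0 = 0"
    unfolding u_def spherical_0 using at_0(2-4) by blast+
  \<comment> \<open>The simplex hypothesis covers positive radii; at 0 isotropy provides the
    coordinates.\<close>
  have coords: "has_simplex_coords (tau (f (spherical \<rho> 0 0)))" if "\<rho> \<ge> 0" for \<rho>
    using simplex[of \<rho>] at_0(1) that by (cases "\<rho> = 0") (auto simp: simplex_iff spherical_0)
  have meas: "u n \<in> borel_measurable \<nu>" if "n \<in> {1..5}" for n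
    unfolding u_def[abs_def] measurable_halfline[OF \<nu>] using f that
    by (intro measurable_restrict_space1 borel_measurable_simplex_coord) (auto simp: spectral_density_def)
  have nonneg: "0 \<le> u n \<rho>" if "n \<in> {1..5}" "\<rho> \<ge> 0" for n \<rho>
    using coords[OF that(2)] that(1) by (simp add: has_simplex_coords_def u_def)
  have sum1: "(\<Sum>n=1..5. u n \<rho>) = 1" if "\<rho> \<ge> 0" for \<rho>
    using coords[OF that] by (simp add: has_simplex_coords_def u_def)
  have pole: "f (spherical \<rho> 0 0) = (\<Sum>n=1..5. u n \<rho> *\<^sub>R vertex_tensor n pole)" if "\<rho> \<ge> 0" for \<rho>
  proof (rule tau_inject)
    show "tensor4_symmetric (f (spherical \<rho> 0 0))"
      using psd by (simp add: unit_trace_psd_iff)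
    show "tensor4_symmetric (\<Sum>n=1..5. u n \<rho> *\<^sub>R vertex_tensor n pole)"
      by (intro tensor4_symmetric_sum tensor4_symmetric_vertex_tensor)
    show "tau (f (spherical \<rho> 0 0)) = tau (\<Sum>n=1..5. u n \<rho> *\<^sub>R vertex_tensor n pole)"
      using coords[OF that] by (simp add: has_simplex_coords_def tau_sum tau_vertex_tensor_pole u_def)
  qed
  have fin: "finite_measure_on_halfline (density \<nu> (u n))" if "n \<in> {1..5}" for n
    by (rule spectral_representation(2)[OF \<nu> f]) (use meas nonneg sum1 pole that in blast)+
  \<comment> \<open>The mass at 0 is scaled by the weight there, so the relations between the
    weights at 0 pass to the measures; they are trivial if \<nu> has no atom at 0.\<close>
  have atom: "measure (density \<nu> (u n)) {0} = u n 0 * measure \<nu> {0}" if "n \<in> {1..5}" for n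
    using measure_density_singleton[of \<nu> "u n" 0] meas[OF that] nonneg[OF that] \<nu> halfline_sets_0[OF \<nu>]
    by (simp add: finite_measure_on_halfline_def)
  show ?thesis
  proof (intro exI conjI allI ballI)
    fix x y i j k l
    show "R x y $ i $ j $ k $ l =
        (\<Sum>n=1..5. LINT \<rho>|density \<nu> (u n). spectral_kernel n \<rho> (y - x) i j k l)"
      unfolding of_real_eq_iff[where ?'a = complex, symmetric] R
      by (rule spectral_representation(1)[OF \<nu> f]) (use meas nonneg sum1 pole in blast)+
  qed (use fin atom u_0 in simp_all)
qed

text \<open>The pointwise normalisation of the derivatives is what makes
  \<open>axial_density\<close> admissible at every wave vector; its values on the axis are convex
  combinations of vertices by construction.\<close>

lemma spectral_density_of_expansion:
  fixes R :: "vec3 \<Rightarrow> vec3 \<Rightarrow> tensor4" and \<Phi> :: "nat \<Rightarrow> real measure"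
  assumes \<Phi>: "\<And>n. n \<in> {1..5} \<Longrightarrow> finite_measure_on_halfline (\<Phi> n)"
    and atoms: "measure (\<Phi> 1) {0} = measure (\<Phi> 2) {0}" "measure (\<Phi> 2) {0} = 2 * measure (\<Phi> 4) {0}"
      "measure (\<Phi> 5) {0} = 0"
    and R: "\<And>x y i j k l. R x y $ i $ j $ k $ l =
           (\<Sum>n=1..5. LINT \<rho>|\<Phi> n. spectral_kernel n \<rho> (y - x) i j k l)"
  shows "\<exists>\<nu> f. finite_measure_on_halfline \<nu> \<and> spectral_density f \<and>
        (\<forall>x y i j k l. complex_of_real (R x y $ i $ j $ k $ l) =
           1 / (4 * pi) * (LINT \<rho>|\<nu>. (LBINT \<theta>:{0..pi}. (LBINT \<phi>:{0..2*pi}.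
             exp (\<i> * (spherical \<rho> \<phi> \<theta> \<bullet> (y - x))) * f (spherical \<rho> \<phi> \<theta>) $ i $ j $ k $ l * sin \<theta>)))) \<and>
        (\<forall>\<rho>>0. tau (f (spherical \<rho> 0 0)) \<in> convex hull {D1, D2, D3, D4, D5})"
proof -
  obtain \<nu> and u :: "nat \<Rightarrow> real \<Rightarrow> real" where *: "finite_measure_on_halfline \<nu> \<and>
    (\<forall>n\<in>{1..5}. u n \<in> borel_measurable \<nu> \<and> density \<nu> (\<lambda>\<rho>. ennreal (u n \<rho>)) = \<Phi> n) \<and>
    (\<forall>n \<rho>. 0 \<le> u n \<rho>) \<and> (\<forall>\<rho>. (\<Sum>n=1..5. u n \<rho>) = 1) \<and>
    u 1 0 = u 2 0 \<and> u 2 0 = 2 * u 4 0 \<and> u 5 0 = 0"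
    using ex_common_densities[of \<Phi>, OF _ atoms] \<Phi> by blast
  have \<nu>: "finite_measure_on_halfline \<nu>"
    and meas: "\<And>n. n \<in> {1..5} \<Longrightarrow> u n \<in> borel_measurable \<nu>"
    and nonneg: "\<And>n \<rho>. 0 \<le> u n \<rho>" and sum1: "\<And>\<rho>. (\<Sum>n=1..5. u n \<rho>) = 1"
    and dens: "\<And>n. n \<in> {1..5} \<Longrightarrow> density \<nu> (u n) = \<Phi> n"
    and at_0: "u 1 0 = u 2 0" "u 2 0 = 2 * u 4 0" "u 5 0 = 0"
    using * by blast+
  define f where "f = axial_density u"
  have f: "spectral_density f"
    unfolding f_def using meas measurable_halfline[OF \<nu>] nonneg sum1 at_0
    by (intro spectral_density_axial) auto
  have pole: "f (spherical \<rho> 0 0) = (\<Sum>n=1..5. u n \<rho> *\<^sub>R vertex_tensor n pole)" if "\<rho> \<ge> 0" for \<rho>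
    unfolding f_def using that by (rule axial_density_pole)
  show ?thesis
  proof (intro exI conjI allI impI)
    fix x y i j k l
    show "complex_of_real (R x y $ i $ j $ k $ l) =
           1 / (4 * pi) * (LINT \<rho>|\<nu>. (LBINT \<theta>:{0..pi}. (LBINT \<phi>:{0..2*pi}.
             exp (\<i> * (spherical \<rho> \<phi> \<theta> \<bullet> (y - x))) * f (spherical \<rho> \<phi> \<theta>) $ i $ j $ k $ l * sin \<theta>)))"
    proof -
      have "R x y $ i $ j $ k $ l = (\<Sum>n=1..5. LINT \<rho>|density \<nu> (u n). spectral_kernel n \<rho> (y - x) i j k l)"
        unfolding R by (intro sum.cong refl) (simp add: dens)
      also have "complex_of_real \<dots> = 1 / (4 * pi) * (LINT \<rho>|\<nu>. (LBINT \<theta>:{0..pi}. (LBINT \<phi>:{0..2*pi}.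
             exp (\<i> * (spherical \<rho> \<phi> \<theta> \<bullet> (y - x))) * f (spherical \<rho> \<phi> \<theta>) $ i $ j $ k $ l * sin \<theta>)))"
      by (rule spectral_representation(1)[OF \<nu> f, symmetric]) (use meas nonneg sum1 pole in blast)+
      finally show ?thesis .
    qed
  next
    fix \<rho> :: real assume "\<rho> > 0"
    then show "tau (f (spherical \<rho> 0 0)) \<in> convex hull {D1, D2, D3, D4, D5}"
      using nonneg sum1 by (simp add: pole tau_sum tau_vertex_tensor_pole simplexI del: One_nat_def)
  qed (rule \<nu> f)+
qed

theorem theorem3:
  fixes M :: "'w measure" and \<epsilon> :: "real^3 \<Rightarrow> 'w \<Rightarrow> real^3^3"
  assumes "prob_space M"
    and "S2_random_field M \<epsilon>"
    and "second_order M \<epsilon>"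
    and "mean_square_continuous M \<epsilon>"
    and "wide_sense_homogeneous M \<epsilon>"
    and "wide_sense_isotropic M \<epsilon>"
  shows
    "(\<exists>\<nu> f. finite_measure_on_halfline \<nu> \<and> spectral_density f \<and>
        (\<forall>x y i j k l. complex_of_real (two_point M \<epsilon> x y $ i $ j $ k $ l) =
           1 / (4 * pi) * (LINT \<rho>|\<nu>. (LBINT \<theta>:{0..pi}. (LBINT \<phi>:{0..2*pi}.
             exp (\<i> * (spherical \<rho> \<phi> \<theta> \<bullet> (y - x))) *
             f (spherical \<rho> \<phi> \<theta>) $ i $ j $ k $ l * sin \<theta>)))) \<and>
        (\<forall>\<rho>>0. tau (f (spherical \<rho> 0 0)) \<in> convex hull {D1, D2, D3, D4, D5}))
     \<longleftrightarrow>
     (\<exists>\<Phi>. (\<forall>n\<in>{1..5::nat}. finite_measure_on_halfline (\<Phi> n)) \<and>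
        measure (\<Phi> 1) {0} = measure (\<Phi> 2) {0} \<and>
        measure (\<Phi> 2) {0} = 2 * measure (\<Phi> 4) {0} \<and>
        measure (\<Phi> 5) {0} = 0 \<and>
        (\<forall>x y i j k l. two_point M \<epsilon> x y $ i $ j $ k $ l =
           (\<Sum>n=1..5. LINT \<rho>|\<Phi> n.
              (\<Sum>q=1..5. N_tilde n q \<rho> (norm (y - x)) * L q (y - x) i j k l))))"
proof (intro iffI; elim exE conjE)
  fix \<nu> f
  assume "finite_measure_on_halfline \<nu>" "spectral_density f"
    and "\<forall>x y i j k l. complex_of_real (two_point M \<epsilon> x y $ i $ j $ k $ l) =
      1 / (4 * pi) * (LINT \<rho>|\<nu>. (LBINT \<theta>:{0..pi}. (LBINT \<phi>:{0..2*pi}.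
        exp (\<i> * (spherical \<rho> \<phi> \<theta> \<bullet> (y - x))) * f (spherical \<rho> \<phi> \<theta>) $ i $ j $ k $ l * sin \<theta>)))"
    and "\<forall>\<rho>>0. tau (f (spherical \<rho> 0 0)) \<in> convex hull {D1, D2, D3, D4, D5}"
  then show "\<exists>\<Phi>. (\<forall>n\<in>{1..5::nat}. finite_measure_on_halfline (\<Phi> n)) \<and>
        measure (\<Phi> 1) {0} = measure (\<Phi> 2) {0} \<and>
        measure (\<Phi> 2) {0} = 2 * measure (\<Phi> 4) {0} \<and>
        measure (\<Phi> 5) {0} = 0 \<and>
        (\<forall>x y i j k l. two_point M \<epsilon> x y $ i $ j $ k $ l =
           (\<Sum>n=1..5. LINT \<rho>|\<Phi> n.
              (\<Sum>q=1..5. N_tilde n q \<rho> (norm (y - x)) * L q (y - x) i j k l)))"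
    using expansion_of_spectral_density[of \<nu> f "two_point M \<epsilon>"] unfolding spectral_kernel_def by blast
next
  fix \<Phi> :: "nat \<Rightarrow> real measure"
  assume "\<forall>n\<in>{1..5}. finite_measure_on_halfline (\<Phi> n)"
    "measure (\<Phi> 1) {0} = measure (\<Phi> 2) {0}" "measure (\<Phi> 2) {0} = 2 * measure (\<Phi> 4) {0}"
    "measure (\<Phi> 5) {0} = 0"
    "\<forall>x y i j k l. two_point M \<epsilon> x y $ i $ j $ k $ l =
       (\<Sum>n=1..5. LINT \<rho>|\<Phi> n. (\<Sum>q=1..5. N_tilde n q \<rho> (norm (y - x)) * L q (y - x) i j k l))"
  then show "\<exists>\<nu> f. finite_measure_on_halfline \<nu> \<and> spectral_density f \<and>
        (\<forall>x y i j k l. complex_of_real (two_point M \<epsilon> x y $ i $ j $ k $ l) =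
           1 / (4 * pi) * (LINT \<rho>|\<nu>. (LBINT \<theta>:{0..pi}. (LBINT \<phi>:{0..2*pi}.
             exp (\<i> * (spherical \<rho> \<phi> \<theta> \<bullet> (y - x))) *
             f (spherical \<rho> \<phi> \<theta>) $ i $ j $ k $ l * sin \<theta>)))) \<and>
        (\<forall>\<rho>>0. tau (f (spherical \<rho> 0 0)) \<in> convex hull {D1, D2, D3, D4, D5})"
    using spectral_density_of_expansion[of \<Phi> "two_point M \<epsilon>"] unfolding spectral_kernel_def by blast
qed

end
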